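(* For $n\ge 0$ and $0\le j\le\lfloor n/2\rfloor$, we have $$d_{n,j}(\alpha,t)=\sum_{\substack{\sigma\in\mathcal{CA}_n\\ \mathrm{drop}(\sigma)=j}}t^{\mathrm{fix}(\sigma)}\alpha^{\mathrm{cyc}(\sigma)},$$ $$d_{n,j}(\alpha,t)=\sum_{\substack{\sigma\in\mathcal{A}^1_{n+1}\\ \mathrm{des}(\sigma)=j}}t^{\mathrm{rminda}(\sigma)}\alpha^{\mathrm{rmin}(\sigma)-1},$$ $$d_{n,j}(\alpha,t)=\sum_{\substack{\sigma\in\mathcal{A}^2_{n+1}\\ \mathrm{des}(\sigma)=j}}t^{\mathrm{rminda}(\sigma)}\alpha^{\mathrm{rmin}(\sigma)-1}.$$
   Context: $\mathfrak{S}_m$ is the symmetric group on $[m]=\{1,\dots,m\}$; permutations are also written as words $\sigma=\sigma_1\cdots\sigma_m$. An index $1\le i\le m-1$ is a descent (ascent) if $\sigma_i>\sigma_{i+1}$ ($\sigma_i<\sigma_{i+1}$); $\mathrm{des},\mathrm{asc}$ count these. An index $i$ is a drop if $i>\sigma(i)$, a fixed point if $i=\sigma(i)$; $\mathrm{drop},\mathrm{fix}$ count these and $\mathrm{cyc}$ is the number of cycles (fixed points included). With the convention $\sigma_0=\sigma_{m+1}=0$, a letter $\sigma_i$ is a double ascent if $\sigma_{i-1}<\sigma_i<\sigma_{i+1}$ and a double descent if $\sigma_{i-1}>\sigma_i>\sigma_{i+1}$. $\sigma_i$ is a left-to-right (right-to-left) maximum if it is larger than all letters to its left (right); $\mathrm{lmax},\mathrm{rmax}$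 are their numbers; $\mathrm{lmaxda}$ is the number of left-to-right maxima that are double ascents, $\mathrm{rmaxdd}$ the number of right-to-left maxima that are double descents. $\sigma_i$ is a right-to-left minimum if $\sigma_i<\sigma_j$ for all $j>i$; $\mathrm{rmin}$ is the number of right-to-left minima and $\mathrm{rminda}$ the number of right-to-left minima that are double ascents. Definition of $d_{n,j}$: let $$A_n(x,y,t\,|\,\alpha)=\sum_{\sigma\in\mathfrak{S}_{n+1}}x^{\mathrm{asc}(\sigma)}y^{\mathrm{des}(\sigma)}t^{\mathrm{lmaxda}(\sigma)+\mathrm{rmaxdd}(\sigma)}\alpha^{\mathrm{lmax}(\sigma)+\mathrm{rmax}(\sigma)-2},$$ let $\gamma_{n,j}(\alpha,t)$ be the unique coefficients with $A_n(x,y,t\,|\,\alpha)=\sum_{j=0}^{\lfloor n/2\rfloor}\gamma_{n,j}(\alpha,t)(xy)^j(x+y)^{n-2j}$ (this polynomial is homogeneous of degree $n$ and symmetric in $x,y$), and $d_{n,j}(\alpha,t)=\gamma_{n,j}(\alpha,t)/2^j$. André permutations: let $w=w_1\cdots w_m$ be a word with distinct positive integer letters. For a letter $x$ of $w$, the $x$-factorization is $w=u\,\lambda(x)\,x\,\rho(x)\,v$, where $\lambda(x)$ (resp. $\rho(x)$) is the maximal (possibly empty) contiguous subword immediately to the left (resp. right) of $x$ all of whose letters are greater than $x$. The word $w$ is an André permutation of the first kind (resp. second kind) if it has no $i$ with $1<i<m$ and $w_{i-1}>w_i>w_{i+1}$ and, for each letter $x$: $\lambda(x)=\emptyset$ if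 $\rho(x)=\emptyset$; and if $\lambda(x)\ne\emptyset$ and $\rho(x)\neq\emptyset$ then $\max\lambda(x)<\max\rho(x)$ (resp. $\min\rho(x)<\min\lambda(x)$). The empty word is an André permutation. $\mathcal{A}^1_m$ (resp. $\mathcal{A}^2_m$) is the set of André permutations of the first (resp. second) kind in $\mathfrak{S}_m$. Cycle André permutations: a cycle $(a_1,a_2,\dots,a_k)$ (meaning $a_1\mapsto a_2\mapsto\cdots\mapsto a_k\mapsto a_1$), written with $a_1=\min\{a_1,\dots,a_k\}$, is an André cycle if the word $a_2\cdots a_k$ is an André permutation of the first kind (in particular any $1$-cycle is an André cycle). A permutation is a cycle André permutation if it is a product of disjoint André cycles (i.e., all its cycles are André cycles). $\mathcal{CA}_n$ is the set of cycle André permutations of $[n]$. *)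

theory Defs
  imports
    "HOL-Combinatorics.Multiset_Permutations"
    "HOL-Combinatorics.Permutations"
    "HOL-Combinatorics.Cycles"
    "HOL-Combinatorics.Orbits"
    "HOL-Computational_Algebra.Polynomial"
begin

section \<open>Word statistics\<close>

text \<open>
  The symmetric group on [m] appears in two guises: as the set of words
  \<open>permutations_of_set {1..m}\<close> wherever word statistics are concerned, and as the set of functions
  \<open>{\<sigma>. \<sigma> permutes {1..m}}\<close> wherever the cycle structure is concerned.
\<close>

text \<open>
  Letters are indexed from 1, and the convention that the letters at positions 0 and m + 1
  are 0 is built in.
\<close>

definition letter :: "nat list \<Rightarrow> nat \<Rightarrow> nat" where
  "letter w i = (if 1 \<le> i \<and> i \<le> length w then w ! (i - 1) else 0)"

definition asc :: "nat list \<Rightarrow> nat" where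
  "asc w = card {i \<in> {1..<length w}. letter w i < letter w (i + 1)}"

definition des :: "nat list \<Rightarrow> nat" where
  "des w = card {i \<in> {1..<length w}. letter w i > letter w (i + 1)}"

definition double_ascents :: "nat list \<Rightarrow> nat set" where
  "double_ascents w =
    {i \<in> {1..length w}. letter w (i - 1) < letter w i \<and> letter w i < letter w (i + 1)}"

definition double_descents :: "nat list \<Rightarrow> nat set" where
  "double_descents w =
    {i \<in> {1..length w}. letter w (i - 1) > letter w i \<and> letter w i > letter w (i + 1)}"

definition lr_maxima :: "nat list \<Rightarrow> nat set" where
  "lr_maxima w = {i \<in> {1..length w}. \<forall>j \<in> {1..<i}. letter w j < letter w i}"

definition rl_maxima :: "nat list \<Rightarrow> nat set" where
  "rl_maxima w = {i \<in> {1..length w}. \<forall>j \<in> {i<..length w}. letter w j < letter w i}"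

definition rl_minima :: "nat list \<Rightarrow> nat set" where
  "rl_minima w = {i \<in> {1..length w}. \<forall>j \<in> {i<..length w}. letter w i < letter w j}"

definition lmax :: "nat list \<Rightarrow> nat" where
  "lmax w = card (lr_maxima w)"

definition rmax :: "nat list \<Rightarrow> nat" where
  "rmax w = card (rl_maxima w)"

definition rmin :: "nat list \<Rightarrow> nat" where
  "rmin w = card (rl_minima w)"

definition lmaxda :: "nat list \<Rightarrow> nat" where
  "lmaxda w = card (lr_maxima w \<inter> double_ascents w)"

definition rmaxdd :: "nat list \<Rightarrow> nat" where
  "rmaxdd w = card (rl_maxima w \<inter> double_descents w)"

definition rminda :: "nat list \<Rightarrow> nat" where
  "rminda w = card (rl_minima w \<inter> double_ascents w)"


section \<open>The polynomials and their gamma-coefficients\<close>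

text \<open>
  Polynomials in the four indeterminates are iterated univariate polynomials. The coefficient ring
  \<open>rat poly poly\<close> consists of the polynomials in \<open>\<alpha>\<close> (inner) and \<open>t\<close> (outer); the polynomials
  in \<open>y\<close> (inner) and \<open>x\<close> (outer) over it form the ring \<open>rat poly poly poly poly\<close>.
\<close>

definition var_\<alpha> :: "rat poly poly" where
  "var_\<alpha> = [:[:0, 1:]:]"

definition var_t :: "rat poly poly" where
  "var_t = [:0, 1:]"

definition var_x :: "rat poly poly poly poly" where
  "var_x = [:0, 1:]"

definition var_y :: "rat poly poly poly poly" where
  "var_y = [:[:0, 1:]:]"

definition const_xy :: "rat poly poly \<Rightarrow> rat poly poly poly poly" where
  "const_xy c = [:[:c:]:]"

text \<open>
  Every word over a nonempty set has a left-to-right and a right-to-left maximum, so the natural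
  number subtraction below does not truncate.
\<close>

definition A_poly :: "nat \<Rightarrow> rat poly poly poly poly" where
  "A_poly n = (\<Sum>w \<in> permutations_of_set {1..n + 1}.
     var_x ^ asc w * var_y ^ des w
       * const_xy (var_t ^ (lmaxda w + rmaxdd w) * var_\<alpha> ^ (lmax w + rmax w - 2)))"

text \<open>
  Setting the coefficients with index beyond \<open>n div 2\<close> to zero makes the sequence of
  coefficients unique as a function.
\<close>

definition gamma_coeff :: "nat \<Rightarrow> nat \<Rightarrow> rat poly poly" where
  "gamma_coeff n = (THE g. (\<forall>j > n div 2. g j = 0) \<and>
     A_poly n = (\<Sum>j \<le> n div 2.
       const_xy (g j) * (var_x * var_y) ^ j * (var_x + var_y) ^ (n - 2 * j)))"

definition d_coeff :: "nat \<Rightarrow> nat \<Rightarrow> rat poly poly" where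
  "d_coeff n j = smult [:1 / 2 ^ j:] (gamma_coeff n j)"


section \<open>Andre permutations\<close>

text \<open>
  The words \<open>\<lambda>(x)\<close> and \<open>\<rho>(x)\<close> of the \<open>x\<close>-factorization, for the letter \<open>x\<close> at the (1-based)
  position \<open>i\<close>.
\<close>

definition lam :: "nat list \<Rightarrow> nat \<Rightarrow> nat list" where
  "lam w i = rev (takeWhile (\<lambda>y. y > letter w i) (rev (take (i - 1) w)))"

definition rho :: "nat list \<Rightarrow> nat \<Rightarrow> nat list" where
  "rho w i = takeWhile (\<lambda>y. y > letter w i) (drop i w)"

text \<open>
  The part of the definition common to both kinds. In contrast to
  \<^const>\<open>double_descents\<close>, the condition on consecutive descents only concerns interior positions.
\<close>

definition andre_common :: "nat list \<Rightarrow> bool" where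
  "andre_common w \<longleftrightarrow>
     distinct w \<and> 0 \<notin> set w \<and>
     \<not> (\<exists>i. 1 < i \<and> i < length w \<and>
           letter w (i - 1) > letter w i \<and> letter w i > letter w (i + 1)) \<and>
     (\<forall>i \<in> {1..length w}. rho w i = [] \<longrightarrow> lam w i = [])"

definition andre1 :: "nat list \<Rightarrow> bool" where
  "andre1 w \<longleftrightarrow> andre_common w \<and>
     (\<forall>i \<in> {1..length w}. lam w i \<noteq> [] \<and> rho w i \<noteq> [] \<longrightarrow>
        Max (set (lam w i)) < Max (set (rho w i)))"

definition andre2 :: "nat list \<Rightarrow> bool" where
  "andre2 w \<longleftrightarrow> andre_common w \<and>
     (\<forall>i \<in> {1..length w}. lam w i \<noteq> [] \<and> rho w i \<noteq> [] \<longrightarrow>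
        Min (set (rho w i)) < Min (set (lam w i)))"

definition Andre1 :: "nat \<Rightarrow> nat list set" where
  "Andre1 m = {w \<in> permutations_of_set {1..m}. andre1 w}"

definition Andre2 :: "nat \<Rightarrow> nat list set" where
  "Andre2 m = {w \<in> permutations_of_set {1..m}. andre2 w}"


section \<open>Cycle Andre permutations\<close>

definition drops :: "nat \<Rightarrow> (nat \<Rightarrow> nat) \<Rightarrow> nat" where
  "drops n \<sigma> = card {i \<in> {1..n}. i > \<sigma> i}"

definition fixpts :: "nat \<Rightarrow> (nat \<Rightarrow> nat) \<Rightarrow> nat" where
  "fixpts n \<sigma> = card {i \<in> {1..n}. \<sigma> i = i}"

definition cyc :: "nat \<Rightarrow> (nat \<Rightarrow> nat) \<Rightarrow> nat" where
  "cyc n \<sigma> = card (orbit \<sigma> ` {1..n})"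

text \<open>The argument is the list \<open>[a\<^sub>1, \<dots>, a\<^sub>k]\<close> representing the cycle \<open>a\<^sub>1 \<mapsto> \<dots> \<mapsto> a\<^sub>k \<mapsto> a\<^sub>1\<close>.\<close>

definition andre_cycle :: "nat list \<Rightarrow> bool" where
  "andre_cycle as \<longleftrightarrow> as \<noteq> [] \<and> hd as = Min (set as) \<and> andre1 (tl as)"

text \<open>
  \<open>support \<sigma> a\<close> is the list \<open>[a, \<sigma> a, \<sigma> (\<sigma> a), \<dots>]\<close> of the cycle through \<open>a\<close>; starting at the least
  element of each cycle gives the required normal form.
\<close>

definition CA :: "nat \<Rightarrow> (nat \<Rightarrow> nat) set" where
  "CA n = {\<sigma>. \<sigma> permutes {1..n} \<and>
     (\<forall>a \<in> {1..n}. a = Min (orbit \<sigma> a) \<longrightarrow> andre_cycle (support \<sigma> a))}"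

end

theory Submission
  imports Defs
begin

text \<open>
  Write \<open>s\<close> and \<open>p\<close> for two elements of a commutative ring. Each of the three claimed sums is the
  coefficient of \<open>p\<^sup>j s\<^sup>n\<^sup>-\<^sup>2\<^sup>j\<close> in a sum in which an object with \<open>j\<close> drops (or descents) has weight
  \<open>p\<^sup>j s\<^sup>n\<^sup>-\<^sup>2\<^sup>j\<close> times powers of \<open>t\<close> and \<open>\<alpha>\<close>. The theorem says that all three sums become
  \<open>A\<^sub>n(x, y, t | \<alpha>)\<close> for \<open>s = x + y\<close> and \<open>p = 2xy\<close>: the gamma-expansion of \<open>A\<^sub>n\<close> is unique, and the
  power \<open>2\<^sup>j\<close> in \<open>p\<^sup>j\<close> is the one by which \<open>d\<^sub>n\<^sub>,\<^sub>j\<close> differs from \<open>\<gamma>\<^sub>n\<^sub>,\<^sub>j\<close>.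

  The four sums agree because they obey one recursion,
  \<open>G\<^sub>0 = 1\<close> and
  \<open>G\<^sub>n\<^sub>+\<^sub>1 = \<alpha> (t s G\<^sub>n + p \<Sum>\<^sub>m (n choose m + 1) G\<^sub>m(1, 1) G\<^sub>n\<^sub>-\<^sub>m\<^sub>-\<^sub>1)\<close>
  (the function \<open>path_sum\<close>). In every case one distinguished element is removed together with a set
  \<open>U\<close> of further elements, which form an object without \<open>t\<close> and \<open>\<alpha>\<close>; one element besides the
  distinguished one may be barred from \<open>U\<close>.

  \<^item> In an arbitrary word, let \<open>N\<close> be the largest and \<open>n\<close> the second largest letter. If \<open>n\<close> is to
    the left of \<open>N\<close>, then \<open>n\<close> is a left-to-right maximum, the block \<open>u'\<close> between \<open>n\<close> and \<open>N\<close>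
    contains none, and removing \<open>n u'\<close> changes no other left-to-right or right-to-left maximum.
    An empty block costs \<open>\<alpha> t x\<close>; a nonempty one costs \<open>\<alpha> x y\<close> times its Eulerian weight.
    Words with \<open>n\<close> to the right of \<open>N\<close> are reversals of these, with \<open>x\<close> and \<open>y\<close> interchanged,
    so that \<open>s = x + y\<close> and \<open>p = 2xy\<close> appear (\<open>max_sum_eq_path_sum\<close>).
  \<^item> A word \<open>u m v\<close> with least letter \<open>m\<close> is Andre if and only if \<open>u\<close> and \<open>v\<close> are
    and either \<open>u\<close> is empty or the largest (first kind) or least (second kind) letter besides \<open>m\<close>
    belongs to \<open>v\<close>. The right-to-left minima are \<open>m\<close> and those of \<open>v\<close>
    (\<open>wsum_eq_path_sum\<close>, for both kinds at once).
  \<^item> In a cycle Andre permutation the cycle of the least element \<open>a\<close> is \<open>(a, u)\<close> with \<open>u\<close> any Andre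
    word of the first kind; its drops are the descents of \<open>u\<close> and, if \<open>u\<close> is nonempty, the step back to \<open>a\<close>
    (\<open>cycle_sum_eq_path_sum\<close>).

  Words over arbitrary finite sets of positive letters are used throughout, so that no step needs
  standardization.
\<close>

section \<open>Stepwise statistics and maxima under concatenation\<close>

lemma letter_append:
  "letter (u @ v) i = (if i \<le> length u then letter u i else letter v (i - length u))"
  unfolding letter_def by (auto simp: nth_append)

lemma letter_0 [simp]: "letter w 0 = 0"
  by (simp add: letter_def)

lemma letter_beyond [simp]: "i > length w \<Longrightarrow> letter w i = 0"
  by (simp add: letter_def)

lemma letter_Cons: "letter (x # w) i = (if i = 0 then 0 else if i = 1 then x else letter w (i - 1))"
  by (cases i; cases "i - 1") (auto simp: letter_def)

lemma letter_in_set: "i \<in> {1..length w} \<Longrightarrow> letter w i \<in> set w"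
  by (auto simp: letter_def)

lemma card_plus_image: "card ((+) (k::nat) ` A) = card A"
  by (intro card_image) (auto simp: inj_on_def)

definition steps :: "(nat \<Rightarrow> nat \<Rightarrow> bool) \<Rightarrow> nat list \<Rightarrow> nat" where
  "steps R w = card {i \<in> {1..<length w}. R (letter w i) (letter w (i + 1))}"

lemma asc_eq_steps: "asc = steps (<)" and des_eq_steps: "des = steps (>)"
  by (auto simp: asc_def des_def steps_def fun_eq_iff)

lemma steps_Nil [simp]: "steps R [] = 0" and steps_single [simp]: "steps R [a] = 0"
  by (auto simp: steps_def)

lemma steps_append:
  "steps R (u @ v) =
     steps R u + steps R v + of_bool (u \<noteq> [] \<and> v \<noteq> [] \<and> R (last u) (hd v))"
proof -
  let ?P = "\<lambda>w i. R (letter w i) (letter w (i + 1))"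
  let ?M = "if u \<noteq> [] \<and> v \<noteq> [] \<and> R (last u) (hd v) then {length u} else {}"
  let ?A = "{i \<in> {1..<length u}. ?P u i}"
  let ?B = "{i \<in> {1..<length v}. ?P v i}"
  have mid: "?P (u @ v) (length u) \<longleftrightarrow> R (last u) (hd v)" if "u \<noteq> []" "v \<noteq> []"
    using that by (cases u; cases v) (auto simp: letter_def nth_append last_conv_nth)
  have "{i \<in> {1..<length (u @ v)}. ?P (u @ v) i} = ?A \<union> ((+) (length u) ` ?B \<union> ?M)" (is "?L = ?R")
  proof (rule set_eqI)
    fix i
    consider "i = 0" | "i \<in> {1..<length u}" | "i = length u" "u \<noteq> []" | "i > length u" by force
    then show "i \<in> ?L \<longleftrightarrow> i \<in> ?R"
    proof cases
      case 1 then show ?thesis by auto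
    next
      case 2 then show ?thesis by (auto simp: letter_append)
    next
      case 3
      then show ?thesis using mid by (auto simp: Suc_le_eq)
    next
      case 4
      then obtain k where k: "i = length u + k" "k > 0" by (metis less_imp_add_positive)
      have "i \<in> ?L \<longleftrightarrow> k \<in> ?B" using k by (auto simp: letter_append)
      also have "\<dots> \<longleftrightarrow> i \<in> ?R" using k by auto
      finally show ?thesis .
    qed
  qed
  moreover have "card (?A \<union> ((+) (length u) ` ?B \<union> ?M)) = card ?A + (card ?B + card ?M)"
    by (subst card_Un_disjoint, simp, simp, force, subst card_Un_disjoint)
       (auto simp: card_plus_image)
  ultimately show ?thesis by (simp add: steps_def)
qed

lemma steps_Cons: "steps R (a # w) = steps R w + of_bool (w \<noteq> [] \<and> R a (hd w))"
  using steps_append[of R "[a]" w] by simp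

lemma des_rev: "des (rev w) = asc w" and asc_rev: "asc (rev w) = des w"
  unfolding asc_eq_steps des_eq_steps
  by (induction w) (auto simp: steps_append steps_Cons last_rev)

lemma lr_maxima_split:
  assumes "\<forall>x\<in>set u \<union> set v. x < N"
  shows "lr_maxima (u @ N # v) = insert (length u + 1) (lr_maxima u)"
proof (rule set_eqI)
  fix i
  let ?w = "u @ N # v"
  have lu: "letter ?w j = letter u j" if "j \<le> length u" for j using that by (simp add: letter_append)
  have lN: "letter ?w (Suc (length u)) = N" by (simp add: letter_append letter_Cons)
  have lv: "letter ?w j \<le> N" for j
  proof (cases "j \<in> {1..length ?w}")
    case True
    then have "letter ?w j \<in> set ?w" by (rule letter_in_set)
    then show ?thesis using assms by (auto dest: less_imp_le)
  qed (auto simp: letter_def)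
  consider "i \<le> length u" | "i = length u + 1" | "i > length u + 1" by force
  then show "i \<in> lr_maxima ?w \<longleftrightarrow> i \<in> insert (length u + 1) (lr_maxima u)"
  proof cases
    case 1 then show ?thesis by (auto simp: lr_maxima_def lu)
  next
    case 2
    have "letter u j < N" if "j \<in> {1..length u}" for j using that assms letter_in_set by blast
    then show ?thesis using 2 by (auto simp: lr_maxima_def lu lN)
  next
    case 3
    then have "\<not> letter ?w (length u + 1) < letter ?w i" "length u + 1 \<in> {1..<i}"
      using lN lv[of i] by auto
    then show ?thesis using 3 by (auto simp: lr_maxima_def)
  qed
qed

lemma lmax_split:
  assumes "\<forall>x\<in>set u \<union> set v. x < N"
  shows "lmax (u @ N # v) = lmax u + 1"
proof -
  have "finite (lr_maxima u)" "length u + 1 \<notin> lr_maxima u" by (auto simp: lr_maxima_def)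
  then show ?thesis by (simp add: lmax_def lr_maxima_split[OF assms])
qed


definition lr_maxda :: "nat list \<Rightarrow> nat set" where
  "lr_maxda w = lr_maxima w \<inter> double_ascents w"

text \<open>
  If \<open>a\<close> exceeds \<open>u\<close> and \<open>u'\<close>, then \<open>a\<close> shields the positions before it from what follows, \<open>u'\<close> holds no
  left-to-right maximum, and \<open>a\<close> itself counts exactly if an ascent follows. Nothing is said about the
  positions within \<open>v\<close>, which the left side cuts off.
\<close>

lemma lr_maxda_split:
  assumes less: "\<forall>x\<in>set u \<union> set u'. x < a" and "0 < a"
  shows "lr_maxda (u @ a # u' @ v) \<inter> {..length u + 1 + length u'} =
           lr_maxda (u @ [a]) \<union> (if a < letter (u' @ v) 1 then {length u + 1} else {})"
    (is "?L = ?R")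
proof (rule set_eqI)
  fix i
  let ?w = "u @ a # u' @ v"
  have lu: "letter ?w j = letter (u @ [a]) j" if "j \<le> Suc (length u)" for j
    using that by (simp add: letter_append letter_Cons)
  have la: "letter ?w (Suc (length u)) = a" by (simp add: letter_append letter_Cons)
  have lnext: "letter ?w (Suc (Suc (length u))) = letter (u' @ v) 1"
    by (subst letter_append) (simp add: letter_Cons)
  consider "i \<le> length u" | "i = length u + 1"
    | "i > length u + 1" "i \<le> length u + 1 + length u'" | "i > length u + 1 + length u'" by linarith
  then show "i \<in> ?L \<longleftrightarrow> i \<in> ?R"
  proof cases
    case 1
    then show ?thesis by (auto simp: lr_maxda_def lr_maxima_def double_ascents_def lu)
  next
    case 2
    have small: "letter ?w j < a" if "j \<le> length u" for j
      using that assms letter_in_set[of j u] by (cases "j = 0") (auto simp: letter_append Suc_le_eq)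
    have "i \<in> lr_maxima ?w" using 2 small by (auto simp: lr_maxima_def la)
    moreover have "i \<in> double_ascents ?w \<longleftrightarrow> a < letter (u' @ v) 1"
      using 2 small by (simp add: double_ascents_def la lnext)
    moreover have "i \<notin> lr_maxda (u @ [a])"
      using 2 by (simp add: lr_maxda_def double_ascents_def letter_append letter_Cons)
    ultimately show ?thesis using 2 by (simp add: lr_maxda_def)
  next
    case 3
    then have "i - length u \<noteq> 0" "i - length u \<noteq> 1" "i - length u - 1 \<le> length u'" by linarith+
    then have "letter ?w i = letter u' (i - Suc (length u))"
      using 3 by (simp add: letter_append letter_Cons)
    also have "\<dots> \<in> set u'" using 3 by (intro letter_in_set) auto
    finally have "letter ?w i < a" using less by blast
    then have "\<not> letter ?w (length u + 1) < letter ?w i" using la by simp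
    moreover have "length u + 1 \<in> {1..<i}" using 3 by auto
    ultimately have "i \<notin> lr_maxima ?w" unfolding lr_maxima_def by blast
    then show ?thesis using 3 by (auto simp: lr_maxda_def lr_maxima_def)
  next
    case 4
    then show ?thesis by (auto simp: lr_maxda_def lr_maxima_def)
  qed
qed

text \<open>
  A letter of \<open>u\<close> does not distinguish between two successors that both exceed it, and the last letter
  never is a double ascent, because the letter after it is 0.
\<close>

lemma lr_maxda_last:
  assumes "\<forall>x\<in>set u. x < a \<and> x < b"
  shows "lr_maxda (u @ [a]) = lr_maxda (u @ [b])"
proof (rule set_eqI)
  fix i
  have lu: "letter (u @ [c]) j = letter u j" if "j \<le> length u" for j c
    using that by (simp add: letter_append)
  have lc: "letter (u @ [c]) (Suc (length u)) = c" "letter (u @ [c]) (Suc (Suc (length u))) = 0" for c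
    by (simp_all add: letter_append letter_Cons)
  have small: "letter u j < a" "letter u j < b" if "1 \<le> j" "j \<le> length u" for j
    using that assms letter_in_set[of j u] by auto
  consider "i < length u" | "i = length u" | "i = length u + 1" | "i > length u + 1" by linarith
  then show "i \<in> lr_maxda (u @ [a]) \<longleftrightarrow> i \<in> lr_maxda (u @ [b])"
    by cases (auto simp: lr_maxda_def lr_maxima_def double_ascents_def lu lc small Suc_le_eq)
qed

lemma lmaxda_split:
  assumes "\<forall>x\<in>set u \<union> set v. x < N" "0 < N"
  shows "lmaxda (u @ N # v) = lmaxda (u @ [N])"
proof -
  have "letter v 1 \<le> N"
    using assms letter_in_set[of 1 v] by (cases "v = []") (auto simp: Suc_le_eq dest: less_imp_le)
  moreover have "lr_maxda (u @ N # v) \<inter> {..length u + 1 + length v} = lr_maxda (u @ N # v)"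
    by (auto simp: lr_maxda_def lr_maxima_def)
  ultimately show ?thesis
    using lr_maxda_split[of u v N "[]"] assms by (simp add: lmaxda_def flip: lr_maxda_def)
qed

text \<open>
  The new letter \<open>n\<close> is a left-to-right maximum. It is a double ascent only if the larger letter \<open>N\<close>
  follows at once; otherwise it is a peak. The letters of \<open>u\<close> keep their status, since the
  last of them is followed by a larger letter before and after the insertion.
\<close>

lemma lmaxda_insert:
  assumes less: "\<forall>x\<in>set u \<union> set u' \<union> set v. x < n" and "0 < n" "n < N"
  shows "lmaxda (u @ n # u' @ N # v) = lmaxda (u @ N # v) + of_bool (u' = [])"
proof -
  let ?U = "u @ n # u'"
  have below: "x < N" if "x \<in> set u \<union> set u' \<union> set v" for x
  proof -
    have "x < n" using that less by blast
    then show ?thesis using \<open>n < N\<close> by simp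
  qed
  have less_U: "\<forall>x\<in>set ?U. x < N" and less_v: "\<forall>x\<in>set v. x < N"
    using below \<open>n < N\<close> by auto
  have eq: "lmaxda (u @ n # u' @ N # v) = lmaxda (?U @ [N])"
  proof -
    have "\<forall>x\<in>set ?U \<union> set v. x < N" using less_U less_v by (simp only: ball_Un simp_thms)
    moreover have "0 < N" using \<open>n < N\<close> by simp
    ultimately
    show ?thesis using lmaxda_split[of ?U v N] by simp
  qed
  have "lr_maxda (?U @ [N]) \<inter> {..length u + 1 + length u'} = lr_maxda (?U @ [N])"
  proof -
    have "length u + length u' + 2 \<notin> double_ascents (?U @ [N])"
      by (auto simp: double_ascents_def)
    then have "i \<noteq> length u + length u' + 2" if "i \<in> lr_maxda (?U @ [N])" for i
      using that by (auto simp: lr_maxda_def)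
    moreover have "i \<le> length u + length u' + 2" if "i \<in> lr_maxda (?U @ [N])" for i
      using that by (auto simp: lr_maxda_def lr_maxima_def)
    ultimately show ?thesis by force
  qed
  then have "lr_maxda (?U @ [N]) =
      lr_maxda (u @ [n]) \<union> (if n < letter (u' @ [N]) 1 then {length u + 1} else {})"
    using lr_maxda_split[of u u' n "[N]"] assms by simp
  moreover have "n < letter (u' @ [N]) 1 \<longleftrightarrow> u' = []"
    using assms by (cases u') (auto simp: letter_Cons)
  moreover have "length u + 1 \<notin> lr_maxda (u @ [n])" "finite (lr_maxda (u @ [n]))"
    by (simp_all add: lr_maxda_def double_ascents_def)
  ultimately have "lmaxda (u @ n # u' @ N # v) = lmaxda (u @ [n]) + of_bool (u' = [])"
    unfolding eq by (simp add: lmaxda_def flip: lr_maxda_def)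
  also have "lmaxda (u @ [n]) = lmaxda (u @ [N])"
    using lr_maxda_last[of u n N] less_U less by (simp add: lmaxda_def flip: lr_maxda_def)
  also have "\<dots> = lmaxda (u @ N # v)"
  proof -
    have "\<forall>x\<in>set u \<union> set v. x < N" using below by auto
    moreover have "0 < N" using \<open>n < N\<close> by simp
    ultimately show ?thesis using lmaxda_split[of u v N] by simp
  qed
  finally show ?thesis .
qed

lemma letter_rev: "i \<le> length w + 1 \<Longrightarrow> letter (rev w) i = letter w (length w + 1 - i)"
  by (auto simp: letter_def rev_nth)

text \<open>
  Equality of cardinalities under the reflection of positions that reversing a word induces.
\<close>

lemma card_reflect:
  assumes "A \<subseteq> {1..n}" "B \<subseteq> {1..n}"
    and "\<And>i. i \<in> A \<Longrightarrow> n + 1 - i \<in> B" "\<And>i. i \<in> B \<Longrightarrow> n + 1 - i \<in> A"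
  shows "card A = card (B :: nat set)"
  using assms by (intro bij_betw_same_card[of "\<lambda>i. n + 1 - i"]
      bij_betw_byWitness[where f' = "\<lambda>i. n + 1 - i"]) force+

lemma lr_maxima_rev_iff:
  assumes "i \<in> {1..length w}"
  shows "length w + 1 - i \<in> lr_maxima (rev w) \<longleftrightarrow> i \<in> rl_maxima w"
proof
  assume L: "length w + 1 - i \<in> lr_maxima (rev w)"
  show "i \<in> rl_maxima w" unfolding rl_maxima_def
  proof (intro CollectI conjI ballI assms)
    fix j assume j: "j \<in> {i<..length w}"
    then have "length w + 1 - j \<in> {1..<length w + 1 - i}" using assms by auto
    with L have "letter (rev w) (length w + 1 - j) < letter (rev w) (length w + 1 - i)"
      by (auto simp: lr_maxima_def)
    then show "letter w j < letter w i" using j assms by (simp add: letter_rev)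
  qed
next
  assume R: "i \<in> rl_maxima w"
  show "length w + 1 - i \<in> lr_maxima (rev w)" unfolding lr_maxima_def
  proof (intro CollectI conjI ballI)
    fix j assume j: "j \<in> {1..<length w + 1 - i}"
    then have "length w + 1 - j \<in> {i<..length w}" using assms by auto
    with R have "letter w (length w + 1 - j) < letter w i"
      by (auto simp: rl_maxima_def)
    moreover have "j \<le> length w + 1" using j by auto
    ultimately show "letter (rev w) j < letter (rev w) (length w + 1 - i)"
      using assms by (simp add: letter_rev)
  qed (use assms in auto)
qed

lemma double_ascents_rev_iff:
  assumes "i \<in> {1..length w}"
  shows "length w + 1 - i \<in> double_ascents (rev w) \<longleftrightarrow> i \<in> double_descents w"
proof -
  have "length w - i = length w + 1 - (i + 1)" "Suc (length w) - i + 1 = length w + 1 - (i - 1)"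
    using assms by auto
  then have "letter (rev w) (length w - i) = letter w (i + 1)"
    "letter (rev w) (length w + 1 - i) = letter w i"
    "letter (rev w) (length w + 1 - i + 1) = letter w (i - 1)"
    using assms by (auto simp: letter_rev)
  note eqs = this
  have "length w + 1 - i - 1 = length w - i" by simp
  moreover have "length w + 1 - i \<in> {1..length (rev w)}" using assms by auto
  ultimately have "length w + 1 - i \<in> double_ascents (rev w) \<longleftrightarrow>
      letter w (i + 1) < letter w i \<and> letter w i < letter w (i - 1)"
    unfolding double_ascents_def mem_Collect_eq by (simp only: eqs simp_thms)
  also have "\<dots> \<longleftrightarrow> i \<in> double_descents w"
    using assms by (auto simp: double_descents_def)
  finally show ?thesis .
qed

lemma lmax_rev: "lmax (rev w) = rmax w"
  unfolding lmax_def rmax_def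
proof (rule card_reflect[of _ "length w"])
  fix i assume i: "i \<in> lr_maxima (rev w)"
  then have "length w + 1 - (length w + 1 - i) = i" "length w + 1 - i \<in> {1..length w}"
    by (auto simp: lr_maxima_def)
  with i show "length w + 1 - i \<in> rl_maxima w" using lr_maxima_rev_iff by metis
next
  fix i assume i: "i \<in> rl_maxima w"
  then show "length w + 1 - i \<in> lr_maxima (rev w)"
    by (subst lr_maxima_rev_iff) (auto simp: rl_maxima_def)
qed (auto simp: lr_maxima_def rl_maxima_def)

lemma lmaxda_rev: "lmaxda (rev w) = rmaxdd w"
  unfolding lmaxda_def rmaxdd_def
proof (rule card_reflect[of _ "length w"])
  fix i assume i: "i \<in> lr_maxima (rev w) \<inter> double_ascents (rev w)"
  then have "length w + 1 - (length w + 1 - i) = i" "length w + 1 - i \<in> {1..length w}"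
    by (auto simp: lr_maxima_def)
  with i show "length w + 1 - i \<in> rl_maxima w \<inter> double_descents w"
    using lr_maxima_rev_iff double_ascents_rev_iff by (metis IntD1 IntD2 IntI)
next
  fix i assume i: "i \<in> rl_maxima w \<inter> double_descents w"
  then have "i \<in> {1..length w}" by (auto simp: rl_maxima_def)
  with i show "length w + 1 - i \<in> lr_maxima (rev w) \<inter> double_ascents (rev w)"
    using lr_maxima_rev_iff double_ascents_rev_iff by blast
qed (auto simp: lr_maxima_def rl_maxima_def)

lemma rmax_rev: "rmax (rev w) = lmax w" and rmaxdd_rev: "rmaxdd (rev w) = lmaxda w"
  using lmax_rev[of "rev w"] lmaxda_rev[of "rev w"] by simp_all

section \<open>The common recursion\<close>

text \<open>
  This is the generating function of increasing trees on \<open>n + 1\<close> nodes with at most two children at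
  each node, along a canonical path from the root to a leaf: at a branching node, the child subtree
  that contains one reserved label continues the path. A node with two children has weight \<open>p\<close>, a
  node with one child has weight \<open>s\<close>, a node of the path other than its leaf has the further factor
  \<open>a\<close>, and one of these with a single child also the factor \<open>t\<close>. In the recursion, \<open>Suc m\<close> is the
  size of the subtree that leaves the path at the root; as it carries no marks, its factor has
  \<open>t = a = 1\<close>.
\<close>

fun path_sum :: "'a::comm_semiring_1 \<Rightarrow> 'a \<Rightarrow> 'a \<Rightarrow> 'a \<Rightarrow> nat \<Rightarrow> 'a" where
  "path_sum p s t a 0 = 1"
| "path_sum p s t a (Suc n) = a * (t * s * path_sum p s t a n
     + p * (\<Sum>m<n. of_nat (n choose Suc m) * (path_sum p s 1 1 m * path_sum p s t a (n - Suc m))))"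

lemma sum_subsets_by_card:
  assumes "finite K"
  shows "(\<Sum>U\<in>Pow K. g (card U)) = (\<Sum>k\<le>card K. of_nat (card K choose k) * g k :: 'a::comm_semiring_1)"
proof -
  have "(\<Sum>U\<in>Pow K. g (card U)) = (\<Sum>k\<le>card K. \<Sum>U | U \<in> Pow K \<and> card U = k. g (card U))"
    using assms by (intro sum.group[symmetric]) (auto simp: card_mono)
  also have "\<dots> = (\<Sum>k\<le>card K. \<Sum>U | U \<in> Pow K \<and> card U = k. g k)"
    by (intro sum.cong refl) auto
  also have "\<dots> = (\<Sum>k\<le>card K. of_nat (card K choose k) * g k)"
    using assms by (simp add: n_subsets Pow_def)
  finally show ?thesis .
qed

text \<open>
  The recursion of \<open>path_sum\<close> on the level of sets: \<open>m\<close> is removed, together with a set \<open>U\<close> of elements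
  of \<open>K\<close> whose contribution is \<open>h U\<close>. Sums over words have \<open>c = 1\<close>, so that \<open>K\<close> lacks a second element
  of \<open>L\<close>, which has to stay; for permutations \<open>c = 0\<close> and \<open>K\<close> is all of \<open>L - {m}\<close>. Which element is
  barred may depend on \<open>L\<close>, and only the cardinalities influence the result.
\<close>

definition removal_step :: "'a::comm_semiring_1 \<Rightarrow> 'a \<Rightarrow> 'a \<Rightarrow> 'a \<Rightarrow> nat \<Rightarrow> (nat set \<Rightarrow> 'a) \<Rightarrow> (nat set \<Rightarrow> 'a) \<Rightarrow> nat set \<Rightarrow> bool"
  where "removal_step p s t a c h f L \<longleftrightarrow>
    (\<exists>m\<in>L. \<exists>K \<subseteq> L - {m}. card L = Suc (card K + c) \<and>
      f L = a * (t * s * f (L - {m}) + p * (\<Sum>U\<in>Pow K - {{}}. h U * f (L - {m} - U))))"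

lemma path_sum_step:
  assumes "finite L" and "removal_step p s t a c h f L"
    and h: "\<And>U. \<lbrakk>U \<subset> L; U \<noteq> {}\<rbrakk> \<Longrightarrow> h U = path_sum p s 1 1 (card U - 1)"
    and f: "\<And>V. \<lbrakk>V \<subset> L; c \<le> card V\<rbrakk> \<Longrightarrow> f V = path_sum p s t a (card V - c)"
  shows "f L = path_sum p s t a (card L - c)"
proof -
  obtain m K where m: "m \<in> L" and K: "K \<subseteq> L - {m}" and cL: "card L = Suc (card K + c)"
    and fL: "f L = a * (t * s * f (L - {m}) + p * (\<Sum>U\<in>Pow K - {{}}. h U * f (L - {m} - U)))"
    using assms(2) unfolding removal_step_def by blast
  define n where "n = card K"
  have "finite K" using K assms(1) finite_subset by blast
  \<comment> \<open>The value 0 at k = 0 absorbs the exclusion of the empty set.\<close>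
  define g where "g k = (if k = 0 then 0 else path_sum p s 1 1 (k - 1) * path_sum p s t a (n - k))" for k
  have cV: "card (L - {m} - U) - c = n - card U \<and> c \<le> card (L - {m} - U)" if "U \<subseteq> K" for U
  proof -
    have "card (L - {m} - U) = card L - 1 - card U"
      using that K m assms(1) by (subst card_Diff_subset) (auto intro: finite_subset)
    moreover have "card U \<le> n" using that \<open>finite K\<close> by (simp add: n_def card_mono)
    ultimately show ?thesis using cL n_def by auto
  qed
  have f': "f (L - {m} - U) = path_sum p s t a (n - card U)" if "U \<subseteq> K" for U
    using f[of "L - {m} - U"] cV[OF that] m by auto
  have "(\<Sum>U\<in>Pow K - {{}}. h U * f (L - {m} - U)) = (\<Sum>U\<in>Pow K - {{}}. g (card U))"
  proof (intro sum.cong refl)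
    fix U assume "U \<in> Pow K - {{}}"
    then have U: "U \<subseteq> K" "U \<noteq> {}" by auto
    moreover from this have "card U \<noteq> 0" using \<open>finite K\<close> by (auto dest: finite_subset)
    moreover have "U \<subset> L" using U K m by blast
    ultimately show "h U * f (L - {m} - U) = g (card U)"
      using h[of U] by (simp add: g_def f')
  qed
  also have "\<dots> = (\<Sum>U\<in>Pow K. g (card U))"
    using \<open>finite K\<close> by (intro sum.mono_neutral_left) (auto simp: g_def)
  also have "\<dots> = (\<Sum>k\<le>n. of_nat (n choose k) * g k)"
    using sum_subsets_by_card[OF \<open>finite K\<close>] by (simp add: n_def)
  also have "\<dots> = (\<Sum>k<n. of_nat (n choose Suc k) * g (Suc k))"
    by (simp add: sum.atMost_shift g_def)
  finally have "(\<Sum>U\<in>Pow K - {{}}. h U * f (L - {m} - U)) = (\<Sum>k<n. of_nat (n choose Suc k) *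
      (path_sum p s 1 1 k * path_sum p s t a (n - Suc k)))"
    by (simp add: g_def)
  then show ?thesis using fL f'[of "{}"] cL by (simp add: n_def[symmetric])
qed

lemma path_sum_unique:
  assumes h: "\<And>U. \<lbrakk>finite U; 0 \<notin> U; U \<noteq> {}\<rbrakk> \<Longrightarrow> h U = path_sum p s 1 1 (card U - 1)"
    and base: "\<And>L. \<lbrakk>finite L; 0 \<notin> L; card L = c\<rbrakk> \<Longrightarrow> f L = 1"
    and step: "\<And>L. \<lbrakk>finite L; 0 \<notin> L; c < card L\<rbrakk> \<Longrightarrow> removal_step p s t a c h f L"
    and "finite L" "0 \<notin> L" "c \<le> card L"
  shows "f L = path_sum p s t a (card L - c)"
  using assms(4-)
proof (induction rule: finite_psubset_induct)
  case (psubset L)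
  show ?case
  proof (cases "card L = c")
    case False
    have sub: "finite V \<and> 0 \<notin> V" if "V \<subset> L" for V
      using psubset.hyps psubset.prems(1) that by (meson finite_subset psubset_imp_subset subsetD)
    show ?thesis
    proof (rule path_sum_step[OF psubset.hyps])
      show "removal_step p s t a c h f L" using step psubset False by simp
      show "h U = path_sum p s 1 1 (card U - 1)" if "U \<subset> L" "U \<noteq> {}" for U
        using h[of U] sub[of U] that by blast
      show "f V = path_sum p s t a (card V - c)" if "V \<subset> L" "c \<le> card V" for V
        using psubset.IH[of V] sub[of V] that by blast
    qed
  qed (simp add: base psubset)
qed

text \<open>
  The instance in which the removed sets are weighted by the function under consideration itself. It
  supplies the premise on \<open>h\<close> of the general statement.
\<close>

lemma path_sum_unique_self:
  fixes f :: "nat set \<Rightarrow> 'a::comm_semiring_1"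
  assumes base: "\<And>L. \<lbrakk>finite L; 0 \<notin> L; card L = 1\<rbrakk> \<Longrightarrow> f L = 1"
    and step: "\<And>L. \<lbrakk>finite L; 0 \<notin> L; 1 < card L\<rbrakk> \<Longrightarrow> removal_step p s 1 1 1 f f L"
    and "finite L" "0 \<notin> L" "L \<noteq> {}"
  shows "f L = path_sum p s 1 1 (card L - 1)"
  using assms(3-)
proof (induction rule: finite_psubset_induct)
  case (psubset L)
  have pos: "card L > 0" using psubset by (simp add: card_gt_0_iff)
  show ?case
  proof (cases "card L = 1")
    case False
    have sub: "finite V \<and> 0 \<notin> V" if "V \<subset> L" for V
      using psubset.hyps psubset.prems(1) that by (meson finite_subset psubset_imp_subset subsetD)
    show ?thesis
    proof (rule path_sum_step[OF psubset.hyps])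
      show "removal_step p s 1 1 1 f f L" using step psubset False pos by simp
      show *: "f U = path_sum p s 1 1 (card U - 1)" if "U \<subset> L" "U \<noteq> {}" for U
        using psubset.IH[of U] sub[of U] that by blast
      show "f V = path_sum p s 1 1 (card V - 1)" if "V \<subset> L" "1 \<le> card V" for V
        using *[of V] that by (cases "V = {}") auto
    qed
  qed (simp add: base psubset)
qed

lemma takeWhile_neq: "a \<notin> set u \<Longrightarrow> takeWhile (\<lambda>x. x \<noteq> a) (u @ a # v) = u"
  and dropWhile_neq: "a \<notin> set u \<Longrightarrow> dropWhile (\<lambda>x. x \<noteq> a) (u @ a # v) = a # v"
  by (induction u) auto

lemma sum_permutations_split:
  assumes "finite L" "a \<in> L"
  shows "(\<Sum>w\<in>permutations_of_set L. f w) = (\<Sum>U\<in>Pow (L - {a}). \<Sum>u\<in>permutations_of_set U.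
           \<Sum>v\<in>permutations_of_set (L - {a} - U). f (u @ a # v))"
proof -
  let ?T = "SIGMA U : Pow (L - {a}). permutations_of_set U \<times> permutations_of_set (L - {a} - U)"
  have "(\<Sum>w\<in>permutations_of_set L. f w) = (\<Sum>(U, u, v)\<in>?T. f (u @ a # v))"
  proof (rule sum.reindex_bij_witness[where j = "\<lambda>w. (set (takeWhile (\<lambda>x. x \<noteq> a) w),
          takeWhile (\<lambda>x. x \<noteq> a) w, tl (dropWhile (\<lambda>x. x \<noteq> a) w))"
        and i = "\<lambda>(U, u, v). u @ a # v"])
    fix w assume "w \<in> permutations_of_set L"
    then have w: "set w = L" "distinct w" by (auto dest: permutations_of_setD)
    with assms obtain u v where uv: "w = u @ a # v" by (metis split_list)
    with w have "a \<notin> set u" "set v = L - {a} - set u" "set u \<subseteq> L - {a}" "distinct u" "distinct v"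
      by auto
    with uv show "(case (set (takeWhile (\<lambda>x. x \<noteq> a) w), takeWhile (\<lambda>x. x \<noteq> a) w,
        tl (dropWhile (\<lambda>x. x \<noteq> a) w)) of (U, u, v) \<Rightarrow> u @ a # v) = w"
      "(set (takeWhile (\<lambda>x. x \<noteq> a) w), takeWhile (\<lambda>x. x \<noteq> a) w,
        tl (dropWhile (\<lambda>x. x \<noteq> a) w)) \<in> ?T"
      "(case (set (takeWhile (\<lambda>x. x \<noteq> a) w), takeWhile (\<lambda>x. x \<noteq> a) w,
        tl (dropWhile (\<lambda>x. x \<noteq> a) w)) of (U, u, v) \<Rightarrow> f (u @ a # v)) = f w"
      by (simp_all add: takeWhile_neq dropWhile_neq permutations_of_set_def)
  next
    fix b assume "b \<in> ?T"
    then obtain U u v where b: "b = (U, u, v)" "U \<subseteq> L - {a}" "set u = U" "distinct u"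
      "set v = L - {a} - U" "distinct v" by (auto simp: permutations_of_set_def)
    then have "a \<notin> set u" "set (u @ a # v) = L" "distinct (u @ a # v)" using assms by auto
    with b show "(case b of (U, u, v) \<Rightarrow> u @ a # v) \<in> permutations_of_set L"
      "(set (takeWhile (\<lambda>x. x \<noteq> a) (case b of (U, u, v) \<Rightarrow> u @ a # v)),
        takeWhile (\<lambda>x. x \<noteq> a) (case b of (U, u, v) \<Rightarrow> u @ a # v),
        tl (dropWhile (\<lambda>x. x \<noteq> a) (case b of (U, u, v) \<Rightarrow> u @ a # v))) = b"
      by (simp_all add: takeWhile_neq dropWhile_neq permutations_of_set_def)
  qed
  also have "\<dots> = (\<Sum>U\<in>Pow (L - {a}). \<Sum>(u, v)\<in>permutations_of_set U \<times> permutations_of_set (L - {a} - U).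
       f (u @ a # v))"
    using assms by (subst sum.Sigma) (auto simp: split_def finite_subset)
  also have "\<dots> = (\<Sum>U\<in>Pow (L - {a}). \<Sum>u\<in>permutations_of_set U.
           \<Sum>v\<in>permutations_of_set (L - {a} - U). f (u @ a # v))"
    by (simp only: sum.cartesian_product)
  finally show ?thesis .
qed

section \<open>All words: removing the second largest letter\<close>

definition max_weight :: "'a::comm_semiring_1 \<Rightarrow> 'a \<Rightarrow> 'a \<Rightarrow> 'a \<Rightarrow> nat list \<Rightarrow> 'a" where
  "max_weight x y t a w =
     x ^ asc w * y ^ des w * (t ^ (lmaxda w + rmaxdd w) * a ^ (lmax w + rmax w - 2))"

definition max_sum :: "'a::comm_semiring_1 \<Rightarrow> 'a \<Rightarrow> 'a \<Rightarrow> 'a \<Rightarrow> nat set \<Rightarrow> 'a" where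
  "max_sum x y t a L = (\<Sum>w\<in>permutations_of_set L. max_weight x y t a w)"

lemma max_weight_rev: "max_weight x y t a (rev w) = max_weight y x t a w"
  by (simp add: max_weight_def asc_rev des_rev lmax_rev rmax_rev lmaxda_rev rmaxdd_rev add.commute
      mult_ac)

text \<open>
  Only \<open>n\<close> is a new maximum, which explains the single factor \<open>a\<close>. If \<open>u'\<close> is empty, there is one more
  ascent, the one from \<open>n\<close> to \<open>N\<close>. Otherwise there are, besides the steps inside \<open>u'\<close>, a new descent from \<open>n\<close>
  and a new ascent to \<open>N\<close>. The step into \<open>n\<close> replaces the step into \<open>N\<close>.
\<close>

lemma max_weight_insert:
  assumes less: "\<forall>z\<in>set u \<union> set u' \<union> set v. z < n" and "0 < n" "n < N"
  shows "max_weight x y t a (u @ n # u' @ N # v) =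
    a * (if u' = [] then t * x else x * y * max_weight x y 1 1 u') * max_weight x y t a (u @ N # v)"
proof -
  have lessN: "z < N" if "z \<in> set u \<union> set u' \<union> set v" for z
  proof -
    have "z < n" using that less by blast
    then show ?thesis using \<open>n < N\<close> by simp
  qed
  have ends: "u \<noteq> [] \<Longrightarrow> last u < n \<and> last u < N" "u' \<noteq> [] \<Longrightarrow> last u' < N \<and> hd u' < n"
    using less lessN by auto
  have "asc (u @ n # u' @ N # v) = asc (u @ N # v) + (if u' = [] then 1 else asc u' + 1)"
    using ends \<open>n < N\<close> by (auto simp: asc_eq_steps steps_append steps_Cons)
  moreover have "des (u @ n # u' @ N # v) = des (u @ N # v) + (if u' = [] then 0 else des u' + 1)"
    using ends \<open>n < N\<close> by (auto simp: des_eq_steps steps_append steps_Cons)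
  moreover have "lmax (u @ n # u' @ N # v) = lmax (u @ N # v) + 1" "lmax (u @ N # v) > 0"
  proof -
    have "lmax ((u @ n # u') @ N # v) = lmax (u @ n # u') + 1"
      using lessN \<open>n < N\<close> by (intro lmax_split) auto
    also have "lmax (u @ n # u') = lmax u + 1" using less by (intro lmax_split) auto
    also have "lmax u + 1 = lmax (u @ N # v)"
      using lessN by (intro lmax_split[symmetric]) auto
    finally show "lmax (u @ n # u' @ N # v) = lmax (u @ N # v) + 1" by simp
    show "lmax (u @ N # v) > 0" using lessN by (subst lmax_split) auto
  qed
  moreover have "rmax (u @ n # u' @ N # v) = rmax (u @ N # v)" "rmax (u @ N # v) > 0"
  proof -
    have "\<forall>z\<in>set (rev v) \<union> set (rev u' @ n # rev u). z < N" "\<forall>z\<in>set (rev v) \<union> set (rev u). z < N"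
      using lessN \<open>n < N\<close> by auto
    then have "lmax (rev v @ N # rev u' @ n # rev u) = lmax (rev v) + 1"
      "lmax (rev v @ N # rev u) = lmax (rev v) + 1"
      using lmax_split by blast+
    then show "rmax (u @ n # u' @ N # v) = rmax (u @ N # v)" "rmax (u @ N # v) > 0"
      by (simp_all add: lmax_rev[symmetric])
  qed
  moreover have "lmaxda (u @ n # u' @ N # v) = lmaxda (u @ N # v) + of_bool (u' = [])"
    by (rule lmaxda_insert[OF assms])
  moreover have "rmaxdd (u @ n # u' @ N # v) = rmaxdd (u @ N # v)"
  proof -
    have "\<forall>z\<in>set (rev v) \<union> set (rev u' @ n # rev u). z < N" "\<forall>z\<in>set (rev v) \<union> set (rev u). z < N" "0 < N"
      using lessN \<open>n < N\<close> by auto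
    then show ?thesis
      using lmaxda_split[of "rev v" "rev u' @ n # rev u" N] lmaxda_split[of "rev v" "rev u" N]
      by (simp add: lmaxda_rev[symmetric])
  qed
  moreover have "lmax (u @ N # v) + 1 + rmax (u @ N # v) - 2 = Suc (lmax (u @ N # v) + rmax (u @ N # v) - 2)"
    using calculation(4,6) by linarith
  ultimately show ?thesis
    by (cases "u' = []") (simp_all add: max_weight_def power_add mult_ac)
qed

text \<open>
  Words in which \<open>n\<close> precedes \<open>N\<close> correspond to pairs of the block between the two letters and the word
  that is left when \<open>n\<close> and this block are deleted; the block is put back directly before \<open>N\<close>.
\<close>

lemma sum_insert_before:
  fixes f g h :: "nat list \<Rightarrow> 'a::comm_semiring_1"
  assumes "finite L" "n \<in> L" "N \<in> L" "n \<noteq> N"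
    and f: "\<And>u u' v. \<lbrakk>set (u @ n # u' @ N # v) = L; distinct (u @ n # u' @ N # v)\<rbrakk> \<Longrightarrow>
        f (u @ n # u' @ N # v) = g u' * h (u @ N # v)"
  shows "(\<Sum>w | w \<in> permutations_of_set L \<and> n \<in> set (takeWhile (\<lambda>x. x \<noteq> N) w). f w) =
    (\<Sum>U\<in>Pow (L - {n, N}). (\<Sum>u\<in>permutations_of_set U. g u) *
       (\<Sum>w\<in>permutations_of_set (L - {n} - U). h w))"
proof -
  let ?P = permutations_of_set
  let ?S = "{w \<in> ?P L. n \<in> set (takeWhile (\<lambda>x. x \<noteq> N) w)}"
  let ?T = "SIGMA U : Pow (L - {n, N}). ?P U \<times> ?P (L - {n} - U)"
  define rest where "rest = (\<lambda>w. tl (dropWhile (\<lambda>x. x \<noteq> n) w))"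
  define del where "del w = (set (takeWhile (\<lambda>x. x \<noteq> N) (rest w)), takeWhile (\<lambda>x. x \<noteq> N) (rest w),
    takeWhile (\<lambda>x. x \<noteq> n) w @ dropWhile (\<lambda>x. x \<noteq> N) (rest w))" for w
  define ins where "ins = (\<lambda>(U :: nat set, u', w).
    takeWhile (\<lambda>x. x \<noteq> N) w @ n # u' @ dropWhile (\<lambda>x. x \<noteq> N) w)"
  have del_eq: "del (u @ n # u' @ N # v) = (set u', u', u @ N # v)" 
    if "distinct (u @ n # u' @ N # v)" for u u' v
    using that by (simp add: del_def rest_def takeWhile_neq dropWhile_neq)
  have ins_eq: "ins (U, u', u @ N # v) = u @ n # u' @ N # v" if "distinct (u @ N # v)" for U u u' v
    using that by (simp add: ins_def takeWhile_neq dropWhile_neq)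
  have "(\<Sum>w\<in>?S. f w) = (\<Sum>(U, u, w)\<in>?T. g u * h w)"
  proof (rule sum.reindex_bij_witness[where j = del and i = ins])
    fix w assume "w \<in> ?S"
    then have w: "set w = L" "distinct w" "n \<in> set (takeWhile (\<lambda>x. x \<noteq> N) w)"
      by (auto dest: permutations_of_setD)
    with assms obtain q v where q: "w = q @ N # v" by (metis split_list)
    then have "n \<in> set q" using w by (simp add: takeWhile_neq)
    then obtain u u' where "q = u @ n # u'" by (metis split_list)
    with q have eq: "w = u @ n # u' @ N # v" by simp
    have *: "set u' \<subseteq> L - {n, N}" "set (u @ N # v) = L - {n} - set u'" "distinct (u @ N # v)"
      "distinct u'" "distinct (u @ n # u' @ N # v)"
      using w(1,2) assms(4) unfolding eq by auto
    show "ins (del w) = w" "del w \<in> ?T"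
      using * unfolding eq by (simp_all add: del_eq ins_eq permutations_of_set_def)
    show "(case del w of (U, u, w) \<Rightarrow> g u * h w) = f w"
      using * f w(1) unfolding eq by (simp add: del_eq)
  next
    fix b assume "b \<in> ?T"
    then obtain U u' w where b: "b = (U, u', w)" "U \<subseteq> L - {n, N}" "set u' = U" "distinct u'"
      "set w = L - {n} - U" "distinct w" by (auto simp: permutations_of_set_def)
    then have "N \<in> set w" using assms by auto
    then obtain u v where w: "w = u @ N # v" by (metis split_list)
    have *: "distinct (u @ N # v)" "distinct (u @ n # u' @ N # v)" "set (u @ n # u' @ N # v) = L" "N \<notin> set u"
      using b(2-) assms(2,3) unfolding w by auto
    show "ins b \<in> ?S" "del (ins b) = b"
      using * assms(4) b(3) unfolding b(1) w ins_eq[OF *(1)] del_eq[OF *(2)]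
      by (simp_all add: permutations_of_set_def takeWhile_neq[of N "u @ n # u'" v, simplified])
  qed
  also have "\<dots> = (\<Sum>U\<in>Pow (L - {n, N}). \<Sum>(u, w)\<in>?P U \<times> ?P (L - {n} - U). g u * h w)"
    using assms(1) by (subst sum.Sigma) (auto simp: split_def finite_subset)
  also have "\<dots> = (\<Sum>U\<in>Pow (L - {n, N}). (\<Sum>u\<in>?P U. g u) * (\<Sum>w\<in>?P (L - {n} - U). h w))"
    by (simp only: sum.cartesian_product[symmetric] sum_product)
  finally show ?thesis .
qed

lemma max_sum_commute: "max_sum x y t a L = max_sum y x t a L"
  unfolding max_sum_def
  by (rule sum.reindex_bij_witness[where i = rev and j = rev])
     (auto simp: max_weight_rev permutations_of_set_def)

lemma max_sum_removal:
  fixes x y t a :: "'a::comm_semiring_1"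
  assumes "finite L" "0 \<notin> L" "1 < card L"
  shows "removal_step (2 * (x * y)) (x + y) t a 1 (max_sum x y 1 1) (max_sum x y t a) L"
proof -
  define N where "N = Max L"
  define n where "n = Max (L - {N})"
  have "L \<noteq> {}" using assms by auto
  then have N: "N \<in> L" "\<And>z. z \<in> L \<Longrightarrow> z \<le> N" using assms(1) by (auto simp: N_def)
  then have "card (L - {N}) > 0" using assms by simp
  then have "L - {N} \<noteq> {}" by (metis card.empty less_numeral_extra(3))
  then have n: "n \<in> L - {N}" using Max_in[of "L - {N}"] assms(1) unfolding n_def by blast
  have n_max: "z \<le> n" if "z \<in> L - {N}" for z using Max_ge[of "L - {N}" z] that assms(1) by (simp add: n_def)
  from n have "n < N" "0 < n" using N assms(2) by (metis DiffE insertI1 le_neq_implies_less, metis DiffE gr0I)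
  define left where "left x y = (\<Sum>w | w \<in> permutations_of_set L \<and>
      n \<in> set (takeWhile (\<lambda>x. x \<noteq> N) w). max_weight x y t a w)" for x y
  define R where "R = (\<Sum>U\<in>Pow (L - {n, N}) - {{}}. max_sum x y 1 1 U * max_sum x y t a (L - {n} - U))"
  have left: "left x' y' = a * (t * x' * max_sum x' y' t a (L - {n}) +
      x' * y' * (\<Sum>U\<in>Pow (L - {n, N}) - {{}}. max_sum x' y' 1 1 U * max_sum x' y' t a (L - {n} - U)))"
    for x' y'
  proof -
    let ?g = "\<lambda>u'. if u' = [] then t * x' else x' * y' * max_weight x' y' 1 1 u'"
    have "left x' y' = (\<Sum>U\<in>Pow (L - {n, N}). (\<Sum>u\<in>permutations_of_set U. a * ?g u) *
       (\<Sum>w\<in>permutations_of_set (L - {n} - U). max_weight x' y' t a w))"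
      unfolding left_def
    proof (rule sum_insert_before)
      fix u u' v assume "set (u @ n # u' @ N # v) = L" "distinct (u @ n # u' @ N # v)"
      then have "z \<in> L - {N}" "z \<noteq> n" if "z \<in> set u \<union> set u' \<union> set v" for z
        using that by auto
      then have "\<forall>z\<in>set u \<union> set u' \<union> set v. z < n" using n_max le_neq_implies_less by blast
      then show "max_weight x' y' t a (u @ n # u' @ N # v) = a * ?g u' * max_weight x' y' t a (u @ N # v)"
        using \<open>0 < n\<close> \<open>n < N\<close> by (rule max_weight_insert)
    qed (use N n assms in auto)
    also have "\<dots> = (\<Sum>U\<in>Pow (L - {n, N}). a * (\<Sum>u\<in>permutations_of_set U. ?g u) *
       max_sum x' y' t a (L - {n} - U))"
      by (simp add: sum_distrib_left max_sum_def)
    also have "\<dots> = a * (t * x' * max_sum x' y' t a (L - {n})) +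
       (\<Sum>U\<in>Pow (L - {n, N}) - {{}}. a * (\<Sum>u\<in>permutations_of_set U. ?g u) * max_sum x' y' t a (L - {n} - U))"
      using assms(1) by (subst sum.remove[of _ "{}"]) (auto simp: mult_ac)
    also have "(\<Sum>U\<in>Pow (L - {n, N}) - {{}}. a * (\<Sum>u\<in>permutations_of_set U. ?g u) * max_sum x' y' t a (L - {n} - U))
       = (\<Sum>U\<in>Pow (L - {n, N}) - {{}}. a * (x' * y') * (max_sum x' y' 1 1 U * max_sum x' y' t a (L - {n} - U)))"
    proof (intro sum.cong refl)
      fix U assume "U \<in> Pow (L - {n, N}) - {{}}"
      then have "(\<Sum>u\<in>permutations_of_set U. ?g u) = (\<Sum>u\<in>permutations_of_set U. x' * y' * max_weight x' y' 1 1 u)"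
        by (intro sum.cong) (auto simp: permutations_of_set_def)
      then show "a * (\<Sum>u\<in>permutations_of_set U. ?g u) * max_sum x' y' t a (L - {n} - U)
        = a * (x' * y') * (max_sum x' y' 1 1 U * max_sum x' y' t a (L - {n} - U))"
        by (simp add: max_sum_def sum_distrib_left[symmetric] mult_ac)
    qed
    finally show ?thesis by (simp add: sum_distrib_left distrib_left mult_ac)
  qed
  \<comment> \<open>Reversal maps the words with n to the right of N to those with n to its left.\<close>
  have "max_sum x y t a L = left x y + left y x"
  proof -
    have "max_sum x y t a L = left x y + (\<Sum>w | w \<in> permutations_of_set L \<and>
        n \<notin> set (takeWhile (\<lambda>x. x \<noteq> N) w). max_weight x y t a w)"
      unfolding max_sum_def left_def
      by (subst sum.union_disjoint[symmetric]) (auto intro!: sum.cong)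
    also have "(\<Sum>w | w \<in> permutations_of_set L \<and>
        n \<notin> set (takeWhile (\<lambda>x. x \<noteq> N) w). max_weight x y t a w) = left y x"
      unfolding left_def
    proof (rule sum.reindex_bij_witness[where i = rev and j = rev])
      have side: "n \<in> set (takeWhile (\<lambda>x. x \<noteq> N) (rev w)) \<longleftrightarrow> n \<notin> set (takeWhile (\<lambda>x. x \<noteq> N) w)"
        if "w \<in> permutations_of_set L" for w
      proof -
        from that have w: "set w = L" "distinct w" by (auto dest: permutations_of_setD)
        with N obtain u v where uv: "w = u @ N # v" by (metis split_list)
        have "N \<notin> set u" "N \<notin> set v" "n \<in> set u \<union> set v" "n \<notin> set u \<inter> set v"
          using w n unfolding uv by auto
        then show ?thesis using \<open>n < N\<close> unfolding uv by (auto simp: takeWhile_neq)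
      qed
      show "rev w \<in> {w \<in> permutations_of_set L. n \<in> set (takeWhile (\<lambda>x. x \<noteq> N) w)}"
        if "w \<in> {w \<in> permutations_of_set L. n \<notin> set (takeWhile (\<lambda>x. x \<noteq> N) w)}" for w
        using that side[of w] by (auto simp: permutations_of_set_def)
      show "rev w \<in> {w \<in> permutations_of_set L. n \<notin> set (takeWhile (\<lambda>x. x \<noteq> N) w)}"
        if "w \<in> {w \<in> permutations_of_set L. n \<in> set (takeWhile (\<lambda>x. x \<noteq> N) w)}" for w
        using that side[of "rev w"] by (auto simp: permutations_of_set_def)
    qed (auto simp: max_weight_rev)
    finally show ?thesis .
  qed
  also have "\<dots> = a * (t * (x + y) * max_sum x y t a (L - {n}) + 2 * (x * y) * R)"
    unfolding left R_def by (simp add: max_sum_commute[of y x] algebra_simps mult_2)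
  finally have "max_sum x y t a L = a * (t * (x + y) * max_sum x y t a (L - {n}) + 2 * (x * y) * R)" .
  moreover have "card L = Suc (card (L - {n, N}) + 1)"
  proof -
    have "card (L - {n, N}) = card L - 2" using n N assms(1) by (subst card_Diff_subset) auto
    then show ?thesis using assms(3) by simp
  qed
  moreover have "n \<in> L" using n by blast
  moreover have "L - {n, N} \<subseteq> L - {n}" by blast
  ultimately show ?thesis unfolding removal_step_def R_def by blast
qed

lemma max_sum_singleton: "a \<noteq> 0 \<Longrightarrow> max_sum x y t c {a} = 1"
proof -
  assume "a \<noteq> 0"
  have "asc [a] = 0" "des [a] = 0" by (simp_all add: asc_eq_steps des_eq_steps)
  moreover have "lmax [a] = 1" using lmax_split[of "[]" "[]" a] by (simp add: lmax_def lr_maxima_def)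
  moreover from this have "rmax [a] = 1" using lmax_rev[of "[a]"] by simp
  moreover have "lmaxda [a] = 0"
    by (auto simp: lmaxda_def double_ascents_def letter_Cons)
  moreover from this have "rmaxdd [a] = 0" using lmaxda_rev[of "[a]"] by simp
  ultimately show ?thesis by (simp add: max_sum_def max_weight_def)
qed

lemma max_sum_eq_path_sum:
  assumes "finite L" "0 \<notin> L" "L \<noteq> {}"
  shows "max_sum x y t a L = path_sum (2 * (x * y)) (x + y) t a (card L - 1)"
proof (rule path_sum_unique)
  fix U :: "nat set" assume "finite U" "0 \<notin> U" "U \<noteq> {}"
  then show "max_sum x y 1 1 U = path_sum (2 * (x * y)) (x + y) 1 1 (card U - 1)"
    by (intro path_sum_unique_self max_sum_removal)
       (auto simp: max_sum_singleton card_1_singleton_iff)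
next
  fix L :: "nat set" assume "finite L" "0 \<notin> L" "1 < card L"
  then show "removal_step (2 * (x * y)) (x + y) t a 1 (max_sum x y 1 1) (max_sum x y t a) L"
    by (rule max_sum_removal)
qed (use assms in \<open>auto simp: max_sum_singleton card_1_singleton_iff Suc_le_eq card_gt_0_iff\<close>)

section \<open>Andre words: removing the least letter\<close>

text \<open>
  The words \<open>lam w i\<close> and \<open>rho w i\<close> are the left and right subtree of the \<open>i\<close>-th letter in the
  increasing binary tree of \<open>w\<close>, so this states that \<open>C\<close> holds at every node.
\<close>

definition all_nodes :: "(nat list \<Rightarrow> nat list \<Rightarrow> bool) \<Rightarrow> nat list \<Rightarrow> bool" where
  "all_nodes C w \<longleftrightarrow> (\<forall>i\<in>{1..length w}. C (lam w i) (rho w i))"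

text \<open>
  The least letter \<open>m\<close> is the root of the tree, with subtrees \<open>u\<close> and \<open>v\<close>: it ends every factor around
  another letter that reaches it, while its own two factors extend to the ends of the word.
\<close>

lemma lam_rho_split:
  assumes "\<forall>x\<in>set u \<union> set v. m < x"
  shows "i \<in> {1..length u} \<Longrightarrow> lam (u @ m # v) i = lam u i \<and> rho (u @ m # v) i = rho u i"
    and "lam (u @ m # v) (length u + 1) = u \<and> rho (u @ m # v) (length u + 1) = v"
    and "i \<in> {1..length v} \<Longrightarrow>
       lam (u @ m # v) (length u + 1 + i) = lam v i \<and> rho (u @ m # v) (length u + 1 + i) = rho v i"
proof -
  let ?w = "u @ m # v"
  {
    assume i: "i \<in> {1..length u}"
    have l: "letter ?w i = letter u i" using i by (simp add: letter_append)
    have "m < letter u i" using i assms letter_in_set[of i u] by blast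
    then show "lam (u @ m # v) i = lam u i \<and> rho (u @ m # v) i = rho u i"
      using i unfolding lam_def rho_def l by (auto simp: takeWhile_tail)
  next
    have l: "letter ?w (length u + 1) = m" by (simp add: letter_append letter_Cons)
    show "lam (u @ m # v) (length u + 1) = u \<and> rho (u @ m # v) (length u + 1) = v"
      using assms unfolding lam_def rho_def l by (auto simp: takeWhile_eq_all_conv rev_swap)
  next
    assume i: "i \<in> {1..length v}"
    have l: "letter ?w (length u + 1 + i) = letter v i" using i by (auto simp: letter_append letter_Cons)
    have "m < letter v i" using i assms letter_in_set[of i v] by blast
    moreover obtain k where k: "i = Suc k" using i by (cases i) auto
    ultimately show "lam (u @ m # v) (length u + 1 + i) = lam v i \<and> rho (u @ m # v) (length u + 1 + i) = rho v i"
      unfolding lam_def rho_def l by (auto simp: takeWhile_tail)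
  }
qed

lemma all_nodes_split:
  assumes "\<forall>x\<in>set u \<union> set v. m < x"
  shows "all_nodes C (u @ m # v) \<longleftrightarrow> all_nodes C u \<and> C u v \<and> all_nodes C v"
proof -
  have eq: "{1..length (u @ m # v)} =
      {1..length u} \<union> {length u + 1} \<union> (+) (length u + 1) ` {1..length v}"
    unfolding image_add_atLeastAtMost by auto
  show ?thesis unfolding all_nodes_def eq
    using lam_rho_split[OF assms] by (auto simp: ball_Un)
qed

text \<open>
  The middle letter of a double descent has a nonempty left and an empty right subtree, so the
  condition at the nodes rules out double descents.
\<close>

lemma andre_common_iff:
  "andre_common w \<longleftrightarrow> distinct w \<and> 0 \<notin> set w \<and> all_nodes (\<lambda>l r. r = [] \<longrightarrow> l = []) w"
proof -
  have "\<not> (letter w (i - 1) > letter w i \<and> letter w i > letter w (i + 1))"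
    if C: "\<forall>i\<in>{1..length w}. rho w i = [] \<longrightarrow> lam w i = []" and i: "1 < i" "i < length w" for i
  proof
    assume d: "letter w (i - 1) > letter w i \<and> letter w i > letter w (i + 1)"
    have "drop i w = letter w (i + 1) # drop (Suc i) w"
      using i by (simp add: letter_def Cons_nth_drop_Suc)
    then have "rho w i = []" using d by (simp add: rho_def)
    moreover have "take (i - 1) w = take (i - 2) w @ [letter w (i - 1)]"
    proof -
      have "i - 1 = Suc (i - 2)" "i - 2 < length w" using i by auto
      then show ?thesis by (simp add: letter_def take_Suc_conv_app_nth)
    qed
    then have "lam w i \<noteq> []" using d by (simp add: lam_def)
    ultimately show False using C i by auto
  qed
  then show ?thesis unfolding andre_common_def all_nodes_def by blast
qed

text \<open>
  The letters of \<open>u\<close> are followed by the smaller letter \<open>m\<close>, hence never are right-to-left minima.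
\<close>

lemma rl_minima_split:
  assumes "\<forall>x\<in>set u \<union> set v. m < x"
  shows "rl_minima (u @ m # v) = insert (length u + 1) ((+) (length u + 1) ` rl_minima v)"
proof (rule set_eqI)
  fix i
  let ?w = "u @ m # v"
  have lm: "letter ?w (Suc (length u)) = m" by (simp add: letter_append letter_Cons)
  have lv: "letter ?w (length u + 1 + k) = letter v k" if "k > 0" for k
    using that by (simp add: letter_append letter_Cons)
  have "i \<le> length u \<or> i = length u + 1 \<or> (\<exists>k>0. i = length u + 1 + k)" by presburger
  then consider "i \<le> length u" | "i = length u + 1" | k where "i = length u + 1 + k" "k > 0"
    by blast
  then show "i \<in> rl_minima ?w \<longleftrightarrow> i \<in> insert (length u + 1) ((+) (length u + 1) ` rl_minima v)"
  proof cases
    case 1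
    have "i \<notin> rl_minima ?w"
    proof
      assume "i \<in> rl_minima ?w"
      then have "i \<in> {1..length u}" "letter ?w i < letter ?w (length u + 1)"
        using 1 by (auto simp: rl_minima_def)
      moreover from this have "m < letter u i" using assms letter_in_set[of i u] by blast
      ultimately show False using lm 1 by (simp add: letter_append)
    qed
    then show ?thesis using 1 by auto
  next
    case 2
    have "m < letter ?w j" if j: "j \<in> {i<..length ?w}" for j
    proof -
      obtain k where k: "j = length u + 1 + k" "k > 0"
        using j 2 less_imp_add_positive[of "length u + 1" j] by auto
      then show ?thesis using j lv[of k] letter_in_set[of k v] assms by auto
    qed
    then show ?thesis using 2 lm by (auto simp: rl_minima_def)
  next
    case 3
    have "i \<in> rl_minima ?w \<longleftrightarrow> k \<in> rl_minima v"
    proof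
      assume *: "i \<in> rl_minima ?w"
      have "letter v k < letter v j" if "j \<in> {k<..length v}" for j
      proof -
        have "length u + 1 + j \<in> {i<..length ?w}" using that 3 by auto
        with * have "letter ?w i < letter ?w (length u + 1 + j)" by (simp add: rl_minima_def)
        then show ?thesis using that 3 lv[of j] lv[of k] by simp
      qed
      then show "k \<in> rl_minima v" using * 3 by (auto simp: rl_minima_def)
    next
      assume *: "k \<in> rl_minima v"
      have "letter ?w i < letter ?w j" if "j \<in> {i<..length ?w}" for j
      proof -
        define l where "l = j - (length u + 1)"
        have l: "j = length u + 1 + l" "l \<in> {k<..length v}" using that 3 by (auto simp: l_def)
        then have "letter v k < letter v l" using * by (auto simp: rl_minima_def)
        then show ?thesis using l 3 lv[of l] lv[of k] by simp
      qed
      then show "i \<in> rl_minima ?w" using * 3 by (auto simp: rl_minima_def)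
    qed
    then show ?thesis using 3 by auto
  qed
qed

lemma rmin_split:
  assumes "\<forall>x\<in>set u \<union> set v. m < x"
  shows "rmin (u @ m # v) = rmin v + 1"
proof -
  have "finite (rl_minima v)" "length u + 1 \<notin> (+) (length u + 1) ` rl_minima v"
    by (auto simp: rl_minima_def)
  then show ?thesis by (simp add: rmin_def rl_minima_split[OF assms] card_plus_image del: One_nat_def add_Suc_right)
qed

text \<open>
  A right-to-left minimum is followed by a larger letter unless it is last; thus \<open>m\<close>, which is not last,
  is a double ascent if and only if it has no larger predecessor. The first letter of \<open>v\<close> had
  predecessor 0 in \<open>v\<close> and now has \<open>m\<close>, which is smaller as well, so its status is unchanged.
\<close>

lemma rminda_split:
  assumes "\<forall>x\<in>set u \<union> set v. m < x" "v \<noteq> []" "0 < m"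
  shows "rminda (u @ m # v) = rminda v + of_bool (u = [])"
proof -
  let ?w = "u @ m # v"
  let ?k = "length u + 1"
  let ?M = "if u = [] then {?k} else {}"
  have lm: "letter ?w ?k = m" by (simp add: letter_append letter_Cons)
  have lv: "letter ?w (?k + k) = letter v k" if "k > 0" for k
    using that by (simp add: letter_append letter_Cons)
  have v1: "m < letter v 1" using assms letter_in_set[of 1 v] by (auto simp: Suc_le_eq)
  have "?k \<in> double_ascents ?w \<longleftrightarrow> u = []"
  proof -
    have "letter ?w (length u) < m \<longleftrightarrow> u = []"
    proof (cases "u = []")
      case False
      then have "m < letter u (length u)"
        using assms(1) letter_in_set[of "length u" u] by (auto simp: Suc_le_eq)
      then show ?thesis using False by (simp add: letter_append)
    qed (use \<open>0 < m\<close> in \<open>simp add: letter_append\<close>)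
    then show ?thesis using lm lv[of 1] v1 by (auto simp: double_ascents_def)
  qed
  moreover have "?k + j \<in> double_ascents ?w \<longleftrightarrow> j \<in> double_ascents v" if j: "j \<in> rl_minima v" for j
  proof -
    have j1: "1 \<le> j" "j \<le> length v" using j by (auto simp: rl_minima_def)
    have "letter ?w (?k + j - 1) < letter v j \<longleftrightarrow> letter v (j - 1) < letter v j"
    proof (cases "j = 1")
      case True
      then show ?thesis using v1 lm by simp
    next
      case False
      then have "?k + j - 1 = ?k + (j - 1)" "j - 1 > 0" using j1 by auto
      then show ?thesis using lv[of "j - 1"] by simp
    qed
    moreover have "letter ?w (?k + j + 1) = letter v (j + 1)" using lv[of "j + 1"] by simp
    ultimately show ?thesis using j1 lv[of j] by (simp add: double_ascents_def)
  qed
  ultimately have "rl_minima ?w \<inter> double_ascents ?w =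
      ?M \<union> (+) ?k ` (rl_minima v \<inter> double_ascents v)"
    unfolding rl_minima_split[OF assms(1)] by (auto simp del: One_nat_def)
  moreover have "finite (rl_minima v \<inter> double_ascents v)" "?k \<notin> (+) ?k ` (rl_minima v \<inter> double_ascents v)"
    by (auto simp: rl_minima_def)
  ultimately show ?thesis
    using card_insert_disjoint[of "(+) ?k ` (rl_minima v \<inter> double_ascents v)" ?k]
    unfolding rminda_def by (cases "u = []") (simp_all only: card_plus_image if_True if_False
      simp_thms of_bool_eq Un_empty_left Un_insert_left finite_imageI Suc_eq_plus1 add_0_right)
qed

lemma des_split:
  assumes "\<forall>x\<in>set u \<union> set v. m < x"
  shows "des (u @ m # v) = des v + (if u = [] then 0 else des u + 1)"
proof -
  have "u \<noteq> [] \<Longrightarrow> m < last u" "v \<noteq> [] \<Longrightarrow> m < hd v" using assms by auto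
  then show ?thesis by (auto simp: des_eq_steps steps_append steps_Cons)
qed

definition andre_weight :: "'a::comm_semiring_1 \<Rightarrow> 'a \<Rightarrow> 'a \<Rightarrow> 'a \<Rightarrow> nat list \<Rightarrow> 'a" where
  "andre_weight p s t a w = p ^ des w * s ^ (length w - 1 - 2 * des w) * (t ^ rminda w * a ^ (rmin w - 1))"

text \<open>
  Both kinds of Andre words are determined by the root decomposition, and they differ only in the letter
  \<open>pick X\<close> that is forced into the right subtree among the set \<open>X\<close> of all letters below the root. As the
  number of admissible decompositions does not depend on this choice, both kinds have the same
  generating function.
\<close>

locale andre_kind =
  fixes A :: "nat list \<Rightarrow> bool" and pick :: "nat set \<Rightarrow> nat"
  assumes pick_in: "\<lbrakk>finite X; X \<noteq> {}\<rbrakk> \<Longrightarrow> pick X \<in> X"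
    and A_imp: "A w \<Longrightarrow> distinct w \<and> 0 \<notin> set w"
    and A_Nil: "A []"
    and A_split: "\<lbrakk>distinct (u @ m # v); 0 \<notin> set (u @ m # v); \<forall>x\<in>set u \<union> set v. m < x\<rbrakk> \<Longrightarrow>
      A (u @ m # v) \<longleftrightarrow> A u \<and> A v \<and> (u = [] \<or> pick (set u \<union> set v) \<in> set v)"
begin

lemma A_split': "\<lbrakk>\<forall>x\<in>set u \<union> set v. m < x; A (u @ m # v)\<rbrakk> \<Longrightarrow> A u \<and> A v \<and> (u = [] \<or> v \<noteq> [])"
  using A_imp[of "u @ m # v"] A_split[of u m v] by auto

text \<open>
  A descent ends at the root of a tree with a nonempty left and a nonempty right subtree, and a tree has
  fewer nodes with two children than leaves. The bound makes the exponent of \<open>s\<close> in the weight a true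
  difference.
\<close>

lemma des_bound: "A w \<Longrightarrow> w \<noteq> [] \<Longrightarrow> 2 * des w < length w"
proof (induction "length w" arbitrary: w rule: less_induct)
  case less
  define m where "m = Min (set w)"
  have "m \<in> set w" using less.prems by (simp add: m_def)
  then obtain u v where w: "w = u @ m # v" by (metis split_list)
  have min: "\<forall>x\<in>set u \<union> set v. m < x"
  proof
    fix x assume "x \<in> set u \<union> set v"
    then have "x \<in> set w" "x \<noteq> m" using A_imp[OF less.prems(1)] by (auto simp: w)
    moreover from this have "m \<le> x" by (simp add: m_def)
    ultimately show "m < x" by simp
  qed
  have "A u" "A v" "u = [] \<or> v \<noteq> []" using A_split'[OF min] less.prems(1) w by auto
  moreover have "length u < length w" "length v < length w" by (auto simp: w)
  ultimately have "u \<noteq> [] \<Longrightarrow> 2 * des u < length u" "v \<noteq> [] \<Longrightarrow> 2 * des v < length v"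
    using less.hyps by auto
  moreover have "des w = des v + (if u = [] then 0 else des u + 1)"
    unfolding w by (rule des_split[OF min])
  ultimately show ?case using \<open>u = [] \<or> v \<noteq> []\<close>
    by (cases "u = []"; cases "v = []") (auto simp: w des_eq_steps)
qed

definition words :: "nat set \<Rightarrow> nat list set" where
  "words L = {w \<in> permutations_of_set L. A w}"

definition wsum :: "'a::comm_semiring_1 \<Rightarrow> 'a \<Rightarrow> 'a \<Rightarrow> 'a \<Rightarrow> nat set \<Rightarrow> 'a" where
  "wsum p s t a L = (\<Sum>w\<in>words L. andre_weight p s t a w)"

lemma finite_words [simp]: "finite L \<Longrightarrow> finite (words L)"
  by (simp add: words_def)

lemma weight_split:
  assumes min: "\<forall>x\<in>set u \<union> set v. m < x" and "0 < m" "A u" "A v" "v \<noteq> []"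
  shows "andre_weight p s t a (u @ m # v) = a * (if u = [] then t * s else p * andre_weight p s 1 1 u) * andre_weight p s t a v"
proof -
  have "rmin v > 0"
  proof -
    have "length v \<in> rl_minima v" "finite (rl_minima v)" using assms(5) by (auto simp: rl_minima_def Suc_le_eq)
    then show ?thesis by (auto simp: rmin_def card_gt_0_iff)
  qed
  then have r: "rmin (u @ m # v) - 1 = Suc (rmin v - 1)" using rmin_split[OF min] by simp
  have bv: "2 * des v < length v" using des_bound assms by blast
  show ?thesis
  proof (cases "u = []")
    case True
    have "length v - 2 * des v = Suc (length v - 1 - 2 * des v)" using bv by arith
    then show ?thesis using r True des_split[OF min] rminda_split[OF min assms(5,2)]
      by (simp add: andre_weight_def mult_ac)
  next
    case False
    then have "2 * des u < length u" using des_bound assms by blast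
    then obtain j where "length u = Suc (2 * des u + j)" using less_iff_Suc_add by blast
    moreover obtain k where "length v = Suc (2 * des v + k)" using bv less_iff_Suc_add by blast
    ultimately have "length u + length v - 2 * (des v + (des u + 1)) =
        (length u - 1 - 2 * des u) + (length v - 1 - 2 * des v)" by simp
    then show ?thesis using r False des_split[OF min] rminda_split[OF min assms(5,2)]
      by (simp add: andre_weight_def power_add mult_ac del: mult_Suc_right add_mult_distrib2)
  qed
qed

text \<open>
  Splitting at the least letter \<open>m\<close>: a nonempty left part may consist of any letters other than \<open>m\<close> and
  \<open>z = pick (L - {m})\<close>, and the remaining letters form the right part.
\<close>

lemma wsum_removal:
  fixes p s t a :: "'a::comm_semiring_1"
  assumes L: "finite L" "0 \<notin> L" "1 < card L"
  shows "removal_step p s t a 1 (wsum p s 1 1) (wsum p s t a) L"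
proof -
  define m where "m = Min L"
  define z where "z = pick (L - {m})"
  define K where "K = L - {m} - {z}"
  have "L \<noteq> {}" using L by auto
  then have m: "m \<in> L" using L(1) by (simp add: m_def)
  have min: "m < x" if "x \<in> L - {m}" for x
  proof -
    have "m \<le> x" using that L(1) by (simp add: m_def)
    then show ?thesis using that by auto
  qed
  have "0 < m" using m L(2) by (metis gr0I)
  have "card (L - {m}) > 0" using m L by simp
  then have "L - {m} \<noteq> {}" by (metis card.empty less_numeral_extra(3))
  then have z: "z \<in> L - {m}" using pick_in[of "L - {m}"] L(1) unfolding z_def by blast
  let ?P = permutations_of_set
  let ?g = "\<lambda>u. if u = [] then t * s else p * andre_weight p s 1 1 u"
  have summand: "(if A (u @ m # v) then andre_weight p s t a (u @ m # v) else 0) =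
      (if u = [] \<or> z \<notin> U then (if A u then a * ?g u else 0) * (if A v then andre_weight p s t a v else 0) else 0)"
    if "U \<subseteq> L - {m}" "u \<in> ?P U" "v \<in> ?P (L - {m} - U)" for U u v
  proof -
    have sets: "set u = U" "set v = L - {m} - U" "distinct u" "distinct v"
      using that by (auto dest: permutations_of_setD)
    have uv: "set u \<union> set v = L - {m}" using sets that by auto
    have less: "\<forall>x\<in>set u \<union> set v. m < x" unfolding uv using min by blast
    have "distinct (u @ m # v)" using sets that by auto
    moreover have "set (u @ m # v) = L" using uv m by auto
    then have "0 \<notin> set (u @ m # v)" using L(2) by simp
    ultimately have iff: "A (u @ m # v) \<longleftrightarrow> A u \<and> A v \<and> (u = [] \<or> z \<notin> U)"
      using A_split[OF _ _ less] z sets(2) unfolding uv z_def[symmetric] by blast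
    moreover have "v \<noteq> []" if "u = [] \<or> z \<notin> U"
    proof -
      have "z \<notin> U" using that z sets(1) by (cases "u = []") simp_all
      then have "z \<in> set v" using z sets(2) by simp
      then show ?thesis by (metis empty_iff list.set(1))
    qed
    ultimately show ?thesis
      using weight_split[OF less \<open>0 < m\<close>, of p s t a] by (cases "A u \<and> A v \<and> (u = [] \<or> z \<notin> U)") auto
  qed
  have "wsum p s t a L = (\<Sum>w\<in>?P L. if A w then andre_weight p s t a w else 0)"
    using L(1) unfolding wsum_def words_def by (subst sum.inter_filter) auto
  also have "\<dots> = (\<Sum>U\<in>Pow (L - {m}). \<Sum>u\<in>?P U. \<Sum>v\<in>?P (L - {m} - U).
      if A (u @ m # v) then andre_weight p s t a (u @ m # v) else 0)"
    by (rule sum_permutations_split[OF L(1) m])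
  also have "\<dots> = (\<Sum>U\<in>Pow (L - {m}). \<Sum>u\<in>?P U. \<Sum>v\<in>?P (L - {m} - U).
      if u = [] \<or> z \<notin> U then (if A u then a * ?g u else 0) * (if A v then andre_weight p s t a v else 0) else 0)"
    using summand by (intro sum.cong refl) auto
  also have "\<dots> = (\<Sum>U\<in>Pow (L - {m}). if U = {} \<or> z \<notin> U then
      (\<Sum>u\<in>?P U. if A u then a * ?g u else 0) * wsum p s t a (L - {m} - U) else 0)"
  proof (intro sum.cong refl)
    fix U assume U: "U \<in> Pow (L - {m})"
    have "u = [] \<longleftrightarrow> U = {}" if "u \<in> ?P U" for u using that by (auto dest: permutations_of_setD)
    moreover have "wsum p s t a (L - {m} - U) = (\<Sum>v\<in>?P (L - {m} - U). if A v then andre_weight p s t a v else 0)"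
      using L(1) unfolding wsum_def words_def by (subst sum.inter_filter) auto
    ultimately show "(\<Sum>u\<in>?P U. \<Sum>v\<in>?P (L - {m} - U).
        if u = [] \<or> z \<notin> U then (if A u then a * ?g u else 0) * (if A v then andre_weight p s t a v else 0) else 0)
      = (if U = {} \<or> z \<notin> U then (\<Sum>u\<in>?P U. if A u then a * ?g u else 0) * wsum p s t a (L - {m} - U) else 0)"
      by (simp add: sum_product cong: sum.cong)
  qed
  also have "\<dots> = (\<Sum>U\<in>Pow K. (\<Sum>u\<in>?P U. if A u then a * ?g u else 0) * wsum p s t a (L - {m} - U))"
    using L(1) by (intro sum.mono_neutral_cong_right) (auto simp: K_def)
  also have "\<dots> = a * (t * s) * wsum p s t a (L - {m}) +
     (\<Sum>U\<in>Pow K - {{}}. (\<Sum>u\<in>?P U. if A u then a * ?g u else 0) * wsum p s t a (L - {m} - U))"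
    using L(1) by (subst sum.remove[of _ "{}"]) (auto simp: K_def A_Nil)
  also have "(\<Sum>U\<in>Pow K - {{}}. (\<Sum>u\<in>?P U. if A u then a * ?g u else 0) * wsum p s t a (L - {m} - U)) =
     (\<Sum>U\<in>Pow K - {{}}. a * (p * (wsum p s 1 1 U * wsum p s t a (L - {m} - U))))"
  proof (intro sum.cong refl)
    fix U assume "U \<in> Pow K - {{}}"
    then have "finite U" "U \<noteq> {}" using L(1) by (auto simp: K_def intro: finite_subset)
    then have "(\<Sum>u\<in>?P U. if A u then a * ?g u else 0) = (\<Sum>u\<in>?P U. if A u then a * p * andre_weight p s 1 1 u else 0)"
      by (intro sum.cong) (auto simp: permutations_of_set_def mult_ac)
    also have "\<dots> = (\<Sum>u\<in>words U. a * p * andre_weight p s 1 1 u)"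
      using \<open>finite U\<close> unfolding words_def by (subst sum.inter_filter) auto
    finally show "(\<Sum>u\<in>?P U. if A u then a * ?g u else 0) * wsum p s t a (L - {m} - U) =
        a * (p * (wsum p s 1 1 U * wsum p s t a (L - {m} - U)))"
      by (simp add: wsum_def sum_distrib_left[symmetric] mult_ac)
  qed
  finally have "wsum p s t a L = a * (t * s * wsum p s t a (L - {m}) +
      p * (\<Sum>U\<in>Pow K - {{}}. wsum p s 1 1 U * wsum p s t a (L - {m} - U)))"
    by (simp add: sum_distrib_left distrib_left mult_ac)
  moreover have "card L = Suc (card K + 1)" using m z L by (simp add: K_def)
  moreover have "K \<subseteq> L - {m}" by (auto simp: K_def)
  ultimately show ?thesis using m unfolding removal_step_def by blast
qed

lemma wsum_singleton: "b \<noteq> 0 \<Longrightarrow> wsum p s t a {b} = 1"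
proof -
  assume "b \<noteq> 0"
  then have "A [b]" using A_split[of "[]" b "[]"] A_Nil by simp
  then have "words {b} = {[b]}" by (auto simp: words_def)
  moreover have "rmin [b] = 1" using rmin_split[of "[]" "[]" b] by (simp add: rmin_def rl_minima_def)
  moreover have "rminda [b] = 0" by (auto simp: rminda_def double_ascents_def letter_Cons)
  ultimately show ?thesis by (simp add: wsum_def andre_weight_def des_eq_steps)
qed

lemma wsum_eq_path_sum:
  assumes "finite L" "0 \<notin> L" "L \<noteq> {}"
  shows "wsum p s t a L = path_sum p s t a (card L - 1)"
proof (rule path_sum_unique)
  fix U :: "nat set" assume "finite U" "0 \<notin> U" "U \<noteq> {}"
  then show "wsum p s 1 1 U = path_sum p s 1 1 (card U - 1)"
    by (intro path_sum_unique_self wsum_removal)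
       (auto simp: wsum_singleton card_1_singleton_iff)
next
  fix L :: "nat set" assume "finite L" "0 \<notin> L" "1 < card L"
  then show "removal_step p s t a 1 (wsum p s 1 1) (wsum p s t a) L"
    by (rule wsum_removal)
qed (use assms in \<open>auto simp: wsum_singleton card_1_singleton_iff Suc_le_eq card_gt_0_iff\<close>)

end

lemma andre1_iff: "andre1 w \<longleftrightarrow> distinct w \<and> 0 \<notin> set w \<and>
   all_nodes (\<lambda>l r. (r = [] \<longrightarrow> l = []) \<and> (l \<noteq> [] \<and> r \<noteq> [] \<longrightarrow> Max (set l) < Max (set r))) w"
  unfolding andre1_def andre_common_iff all_nodes_def by auto

lemma andre2_iff: "andre2 w \<longleftrightarrow> distinct w \<and> 0 \<notin> set w \<and>
   all_nodes (\<lambda>l r. (r = [] \<longrightarrow> l = []) \<and> (l \<noteq> [] \<and> r \<noteq> [] \<longrightarrow> Min (set r) < Min (set l))) w"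
  unfolding andre2_def andre_common_iff all_nodes_def by auto

lemma Max_in_right_iff:
  assumes "finite X" "finite Y" "X \<noteq> {}" "X \<inter> Y = {}"
  shows "Max (X \<union> Y) \<in> Y \<longleftrightarrow> Y \<noteq> {} \<and> Max X < Max (Y :: nat set)"
proof (cases "Y = {}")
  case False
  have "Max (X \<union> Y) = max (Max X) (Max Y)" using assms False by (simp add: Max_Un)
  moreover have "Max X \<in> X" "Max Y \<in> Y" using assms False by auto
  ultimately show ?thesis using assms(4) False by (auto simp: max_def split: if_splits)
qed (use assms in auto)

lemma Min_in_right_iff:
  assumes "finite X" "finite Y" "X \<noteq> {}" "X \<inter> Y = {}"
  shows "Min (X \<union> Y) \<in> Y \<longleftrightarrow> Y \<noteq> {} \<and> Min Y < Min (X :: nat set)"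
proof (cases "Y = {}")
  case False
  have "Min (X \<union> Y) = min (Min X) (Min Y)" using assms False by (simp add: Min_Un)
  moreover have "Min X \<in> X" "Min Y \<in> Y" using assms False by auto
  ultimately show ?thesis using assms(4) False by (auto simp: min_def split: if_splits)
qed (use assms in auto)

text \<open>
  In terms of the root decomposition, \<open>Max (set u) < Max (set v)\<close> says that the largest letter besides
  the root lies in \<open>v\<close>. A nonempty \<open>u\<close> and an empty \<open>v\<close> are excluded by the same membership.
\<close>

interpretation A1: andre_kind andre1 Max
proof
  fix u v :: "nat list" and m
  assume uv: "distinct (u @ m # v)" "0 \<notin> set (u @ m # v)" and less: "\<forall>x\<in>set u \<union> set v. m < x"
  have "u = [] \<or> (Max (set u \<union> set v) \<in> set v \<longleftrightarrow> v \<noteq> [] \<and> Max (set u) < Max (set v))"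
    using uv by (cases "u = []") (auto simp: Max_in_right_iff)
  then show "andre1 (u @ m # v) \<longleftrightarrow> andre1 u \<and> andre1 v \<and> (u = [] \<or> Max (set u \<union> set v) \<in> set v)"
    unfolding andre1_iff all_nodes_split[OF less] using uv by auto
qed (auto simp: andre1_iff all_nodes_def)

interpretation A2: andre_kind andre2 Min
proof
  fix u v :: "nat list" and m
  assume uv: "distinct (u @ m # v)" "0 \<notin> set (u @ m # v)" and less: "\<forall>x\<in>set u \<union> set v. m < x"
  have "u = [] \<or> (Min (set u \<union> set v) \<in> set v \<longleftrightarrow> v \<noteq> [] \<and> Min (set v) < Min (set u))"
    using uv by (cases "u = []") (auto simp: Min_in_right_iff)
  then show "andre2 (u @ m # v) \<longleftrightarrow> andre2 u \<and> andre2 v \<and> (u = [] \<or> Min (set u \<union> set v) \<in> set v)"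
    unfolding andre2_iff all_nodes_split[OF less] using uv by auto
qed (auto simp: andre2_iff all_nodes_def)

section \<open>Cycle Andre permutations: removing the cycle of the least element\<close>

lemma funpow_cong:
  assumes "\<And>x. x \<in> S \<Longrightarrow> f x = g x \<and> f x \<in> S" "b \<in> S"
  shows "(f ^^ i) b = (g ^^ i) b" "(f ^^ i) b \<in> S"
proof -
  have "(f ^^ i) b = (g ^^ i) b \<and> (f ^^ i) b \<in> S"
  proof (induction i)
    case (Suc i)
    then show ?case using assms(1)[of "(f ^^ i) b"] by auto
  qed (simp add: assms)
  then show "(f ^^ i) b = (g ^^ i) b" "(f ^^ i) b \<in> S" by auto
qed

text \<open>
  The cycle of \<open>b\<close> depends only on the values on a closed set that contains \<open>b\<close>. This
  transfers cycles between a permutation and its restriction.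
\<close>

lemma support_cong:
  assumes "\<And>x. x \<in> S \<Longrightarrow> f x = g x \<and> f x \<in> S" "b \<in> S"
  shows "support f b = support g b" "orbit f b = orbit g b"
proof -
  have eq: "(f ^^ i) b = (g ^^ i) b" for i using funpow_cong[of S f g b i] assms by blast
  then have "least_power f b = least_power g b" by (simp add: least_power_def)
  with eq show "support f b = support g b" by simp
  show "orbit f b = orbit g b" unfolding orbit_altdef eq ..
qed

lemma cycle_of_list_nth:
  assumes "distinct cs" "k < length cs"
  shows "cycle_of_list cs (cs ! k) = (cs @ [hd cs]) ! Suc k"
proof -
  have "cycle_of_list cs (cs ! k) = rotate1 cs ! k"
  proof -
    have "map (cycle_of_list cs) cs = rotate1 cs"
      using cyclic_rotation[OF assms(1), of 1] by simp
    then show ?thesis using assms(2) by (metis nth_map)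
  qed
  also have "\<dots> = (cs @ [hd cs]) ! Suc k"
    using assms(2) by (cases cs) (auto simp: nth_append)
  finally show ?thesis .
qed

lemma support_cycle_of_list:
  assumes "distinct cs" "cs \<noteq> []"
  shows "support (cycle_of_list cs) (hd cs) = cs"
proof -
  let ?c = "cycle_of_list cs"
  have pow: "(?c ^^ i) (hd cs) = cs ! i" if "i < length cs" for i
    using that
  proof (induction i)
    case 0 then show ?case using assms by (simp add: hd_conv_nth)
  next
    case (Suc i)
    then show ?case using cycle_of_list_nth[OF assms(1), of i] by (simp add: nth_append)
  qed
  have "least_power ?c (hd cs) = length cs"
    unfolding least_power_def
  proof (rule Least_equality)
    show "(?c ^^ length cs) (hd cs) = hd cs \<and> 0 < length cs"
      using cycle_is_id_root[OF assms(1)] assms(2) by simp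
    fix n assume n: "(?c ^^ n) (hd cs) = hd cs \<and> 0 < n"
    show "length cs \<le> n"
    proof (rule ccontr)
      assume "\<not> length cs \<le> n"
      then have "cs ! n = cs ! 0" "n < length cs" using n pow[of n] assms(2) by (auto simp: hd_conv_nth)
      then show False using n assms by (simp add: nth_eq_iff_index_eq)
    qed
  qed
  then show ?thesis using pow by (intro nth_equalityI) simp_all
qed

definition cycle_andre_on :: "nat set \<Rightarrow> (nat \<Rightarrow> nat) set" where
  "cycle_andre_on L = {\<sigma>. \<sigma> permutes L \<and>
     (\<forall>a\<in>L. a = Min (orbit \<sigma> a) \<longrightarrow> andre_cycle (support \<sigma> a))}"

definition drops_on :: "nat set \<Rightarrow> (nat \<Rightarrow> nat) \<Rightarrow> nat" where
  "drops_on L \<sigma> = card {i \<in> L. i > \<sigma> i}"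

definition fixpts_on :: "nat set \<Rightarrow> (nat \<Rightarrow> nat) \<Rightarrow> nat" where
  "fixpts_on L \<sigma> = card {i \<in> L. \<sigma> i = i}"

definition cyc_on :: "nat set \<Rightarrow> (nat \<Rightarrow> nat) \<Rightarrow> nat" where
  "cyc_on L \<sigma> = card (orbit \<sigma> ` L)"

definition add_cycle :: "nat list \<Rightarrow> (nat \<Rightarrow> nat) \<Rightarrow> nat \<Rightarrow> nat" where
  "add_cycle cs \<tau> x = (if x \<in> set cs then cycle_of_list cs x else \<tau> x)"

definition remove_cycle :: "nat list \<Rightarrow> (nat \<Rightarrow> nat) \<Rightarrow> nat \<Rightarrow> nat" where
  "remove_cycle cs \<sigma> x = (if x \<in> set cs then x else \<sigma> x)"

lemma cycle_of_list_in: "x \<in> set cs \<Longrightarrow> cycle_of_list cs x \<in> set cs"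
  using permutes_in_image[OF cycle_permutes] by metis

lemma permutation_onI: "finite L \<Longrightarrow> \<sigma> permutes L \<Longrightarrow> permutation \<sigma>"
  using permutation_permutes by blast

lemma set_support_eq_orbit:
  assumes "permutation \<sigma>"
  shows "set (support \<sigma> a) = orbit \<sigma> a"
  unfolding support_set[OF assms] orbit_altdef_permutation[OF assms] by auto

text \<open>
  The setting of the recursion: a permutation \<open>\<tau>\<close> of the elements outside \<open>a # u\<close> is extended by the
  cycle \<open>a # u\<close> through the least element \<open>a\<close>.
\<close>

locale cycle_extension =
  fixes L :: "nat set" and a :: nat and u :: "nat list" and \<tau> :: "nat \<Rightarrow> nat"
  assumes L: "finite L" "a \<in> L" "\<And>x. x \<in> L \<Longrightarrow> a \<le> x"
    and u: "set u \<subseteq> L - {a}" "distinct u"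
    and \<tau>: "\<tau> permutes L - {a} - set u"
begin

abbreviation (input) "cs \<equiv> a # u"
abbreviation (input) "L' \<equiv> L - {a} - set u"
abbreviation (input) "\<sigma> \<equiv> add_cycle (a # u) \<tau>"

lemma add_cycle_on_cycle: "x \<in> set cs \<Longrightarrow> cycle_of_list cs x = \<sigma> x \<and> cycle_of_list cs x \<in> set cs"
  by (simp only: add_cycle_def cycle_of_list_in if_True simp_thms)

lemma add_cycle_off_cycle: "x \<in> L' \<Longrightarrow> \<tau> x = \<sigma> x \<and> \<tau> x \<in> L'"
  using permutes_in_image[OF \<tau>, of x] by (auto simp: add_cycle_def)

lemma L_decomp: "L = set cs \<union> L'" "set cs \<inter> L' = {}"
  using L u by auto

lemma distinct_cs: "distinct cs"
  using u by auto

lemma add_cycle_permutes: "\<sigma> permutes L"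
proof -
  have "\<sigma> = cycle_of_list cs \<circ> \<tau>"
  proof
    fix x
    have "x \<in> set cs \<Longrightarrow> \<tau> x = x" using permutes_not_in[OF \<tau>] L_decomp(2) by blast
    moreover have "\<tau> x \<notin> set cs" if "x \<notin> set cs"
      using that permutes_not_in[OF \<tau>, of x] permutes_in_image[OF \<tau>, of x] L_decomp(2)
      by (cases "x \<in> L'") (metis disjoint_iff, metis)
    ultimately show "\<sigma> x = (cycle_of_list cs \<circ> \<tau>) x"
      using id_outside_supp[of _ cs] by (simp add: add_cycle_def del: set_simps)
  qed
  moreover have "\<tau> permutes L" by (rule permutes_subset[OF \<tau>]) blast
  moreover have "cycle_of_list cs permutes L"
    by (rule permutes_subset[OF cycle_permutes]) (use L_decomp(1) in blast)
  ultimately show ?thesis by (simp only: permutes_compose)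
qed

lemma support_add_cycle: "support \<sigma> a = cs"
proof -
  have "support (cycle_of_list cs) a = support \<sigma> a"
    by (rule support_cong(1)[OF add_cycle_on_cycle]) simp_all
  then show ?thesis using support_cycle_of_list[OF distinct_cs] by simp
qed

lemma orbit_add_cycle_on: "x \<in> set cs \<Longrightarrow> orbit \<sigma> x = set cs"
proof -
  assume x: "x \<in> set cs"
  have p: "permutation \<sigma>" by (rule permutation_onI[OF L(1) add_cycle_permutes])
  have "orbit \<sigma> a = set cs"
    unfolding set_support_eq_orbit[OF p, symmetric] support_add_cycle ..
  with x show ?thesis using orbit_cyclic_eq3[OF cyclic_on_orbit'[OF p, of a]] by metis
qed

lemma off_cycle_cong: 
  assumes "b \<in> L'" shows "support \<sigma> b = support \<tau> b" "orbit \<sigma> b = orbit \<tau> b"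
  by (simp_all only: support_cong[OF add_cycle_off_cycle assms])

lemma orbit_off_subset: "b \<in> L' \<Longrightarrow> orbit \<tau> b \<subseteq> L'"
  by (rule permutes_orbit_subset[OF \<tau>])

text \<open>
  The cycle of \<open>a\<close> is in normal form as \<open>a # u\<close>, since \<open>a\<close> is least; the other cycles are those of \<open>\<tau>\<close>.
\<close>

lemma add_cycle_andre_iff: "\<sigma> \<in> cycle_andre_on L \<longleftrightarrow> andre1 u \<and> \<tau> \<in> cycle_andre_on L'"
proof -
  let ?Q = "\<lambda>\<sigma> b. b = Min (orbit \<sigma> b) \<longrightarrow> andre_cycle (support \<sigma> b)"
  have min: "Min (set cs) = a"
    using L u by (intro Min_eqI) auto
  have "(\<forall>b\<in>set cs. ?Q \<sigma> b) \<longleftrightarrow> andre_cycle cs"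
  proof -
    have "b = Min (orbit \<sigma> b) \<longleftrightarrow> b = a" if "b \<in> set cs" for b
      using that by (simp only: orbit_add_cycle_on min)
    then show ?thesis using support_add_cycle by (metis list.set_intros(1))
  qed
  also have "\<dots> \<longleftrightarrow> andre1 u" using min by (simp add: andre_cycle_def)
  finally have 1: "(\<forall>b\<in>set cs. ?Q \<sigma> b) \<longleftrightarrow> andre1 u" .
  have 2: "(\<forall>b\<in>L'. ?Q \<sigma> b) \<longleftrightarrow> (\<forall>b\<in>L'. ?Q \<tau> b)"
    using off_cycle_cong by (intro ball_cong refl) (simp only:)
  have "(\<forall>b\<in>L. ?Q \<sigma> b) \<longleftrightarrow> (\<forall>b\<in>set cs. ?Q \<sigma> b) \<and> (\<forall>b\<in>L'. ?Q \<sigma> b)"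
    using L_decomp(1) by blast
  with 1 2 show ?thesis using add_cycle_permutes \<tau> by (simp add: cycle_andre_on_def)
qed

lemma card_split:
  assumes "\<And>x. x \<in> L' \<Longrightarrow> P x = Q x"
  shows "card {x \<in> L. P x} = card {x \<in> L'. Q x} + card {x \<in> set cs. P x}"
proof -
  have "{x \<in> L. P x} = {x \<in> L'. Q x} \<union> {x \<in> set cs. P x}" using L_decomp(1) assms by blast
  moreover have "{x \<in> L'. Q x} \<inter> {x \<in> set cs. P x} = {}" using L_decomp(2) by blast
  moreover have "finite {x \<in> L'. Q x}" using L(1) by simp
  moreover have "finite {x \<in> set cs. P x}" by (rule finite_subset[OF _ finite_set]) blast
  ultimately show ?thesis by (simp only: card_Un_disjoint)
qed

lemma add_cycle_nth: "k < length cs \<Longrightarrow> \<sigma> (cs ! k) = (cs @ [a]) ! Suc k"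
  using cycle_of_list_nth[OF distinct_cs] by (simp only: add_cycle_def nth_mem if_True list.sel)

text \<open>
  The steps of the cycle are the steps of the word \<open>a # u @ [a]\<close>, so its drops are the descents of that
  word: the first step ascends and the last one descends if \<open>u\<close> is nonempty.
\<close>

lemma drops_add_cycle:
  "drops_on L \<sigma> = drops_on L' \<tau> + (if u = [] then 0 else des u + 1)"
proof -
  let ?D = "{i \<in> {1..<length (cs @ [a])}. letter (cs @ [a]) i > letter (cs @ [a]) (i + 1)}"
  have "card {x \<in> set cs. x > \<sigma> x} = card ?D"
  proof (rule bij_betw_same_card[symmetric], rule bij_betw_imageI)
    let ?f = "\<lambda>i. cs ! (i - 1)"
    show "inj_on ?f ?D"
      using distinct_cs by (intro inj_onI) (auto simp: nth_eq_iff_index_eq simp del: distinct.simps nth_Cons_Suc)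
    have l: "letter (cs @ [a]) (k + 1) = cs ! k" "letter (cs @ [a]) (k + 1 + 1) = \<sigma> (cs ! k)"
      if "k < length cs" for k
    proof -
      have "letter (xs @ [a]) (k + 1) = xs ! k" "letter (xs @ [a]) (k + 1 + 1) = (xs @ [a]) ! Suc k"
        if "k < length xs" for xs
        using that by (simp_all add: letter_def nth_append)
      from this[OF that] show "letter (cs @ [a]) (k + 1) = cs ! k"
        "letter (cs @ [a]) (k + 1 + 1) = \<sigma> (cs ! k)"
        by (simp_all only: add_cycle_nth[OF that])
    qed
    show "?f ` ?D = {x \<in> set cs. x > \<sigma> x}"
    proof (intro set_eqI iffI)
      fix x assume "x \<in> ?f ` ?D"
      then obtain i where i: "i \<in> ?D" "x = cs ! (i - 1)" by blast
      then have "i - 1 < length cs" "i - 1 + 1 = i" by auto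
      moreover from this have "x \<in> set cs" using nth_mem[of "i - 1" cs] i(2) by (simp only:)
      ultimately show "x \<in> {x \<in> set cs. x > \<sigma> x}" using i l[of "i - 1"] by simp
    next
      fix x assume x: "x \<in> {x \<in> set cs. x > \<sigma> x}"
      then obtain k where k: "k < length cs" "x = cs ! k" by (metis (no_types, lifting) in_set_conv_nth mem_Collect_eq)
      with l[OF k(1)] x have "k + 1 \<in> ?D" by simp
      moreover have "x = ?f (k + 1)" using k by simp
      ultimately show "x \<in> ?f ` ?D" by blast
    qed
  qed
  also have "\<dots> = des (a # u @ [a])" by (simp add: des_def)
  also have "\<dots> = (if u = [] then 0 else des u + 1)"
  proof -
    have "a < x" if "x \<in> set u" for x
    proof -
      have "a \<le> x" "x \<noteq> a" using L(3)[of x] u that by auto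
      then show ?thesis by simp
    qed
    then have "u \<noteq> [] \<Longrightarrow> a < hd u \<and> a < last u" by simp
    then show ?thesis by (auto simp: des_eq_steps steps_append steps_Cons)
  qed
  finally show ?thesis
    unfolding drops_on_def using add_cycle_off_cycle by (subst card_split[of _ "\<lambda>i. i > \<tau> i"]) auto
qed

lemma fixpts_add_cycle: "fixpts_on L \<sigma> = fixpts_on L' \<tau> + of_bool (u = [])"
proof -
  have "card {x \<in> set cs. \<sigma> x = x} = of_bool (u = [])"
  proof (cases "u = []")
    case True
    then have "{x \<in> set cs. \<sigma> x = x} = {a}" by (auto simp: add_cycle_def)
    then show ?thesis using True by simp
  next
    case False
    have "\<sigma> x \<noteq> x" if "x \<in> set cs" for x
    proof
      assume "\<sigma> x = x"
      then have "orbit \<sigma> x = {x}" by (simp add: orbit_eq_singleton_iff)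
      then have "set cs = {x}" using orbit_add_cycle_on[OF that] by simp
      then show False using distinct_cs False by (cases u) auto
    qed
    then show ?thesis using False by (auto simp: card_eq_0_iff)
  qed
  then show ?thesis
    unfolding fixpts_on_def using add_cycle_off_cycle by (subst card_split[of _ "\<lambda>i. \<tau> i = i"]) auto
qed

lemma cyc_add_cycle: "cyc_on L \<sigma> = cyc_on L' \<tau> + 1"
proof -
  have "orbit \<sigma> ` L = orbit \<sigma> ` set cs \<union> orbit \<sigma> ` L'" using L_decomp(1) by blast
  also have "orbit \<sigma> ` set cs = {set cs}" using orbit_add_cycle_on by auto
  also have "orbit \<sigma> ` L' = orbit \<tau> ` L'" using off_cycle_cong by (intro image_cong) auto
  finally have "orbit \<sigma> ` L = insert (set cs) (orbit \<tau> ` L')" by simp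
  moreover have "set cs \<notin> orbit \<tau> ` L'"
    using orbit_off_subset L_decomp(2) by fastforce
  ultimately show ?thesis using L(1) by (simp add: cyc_on_def)
qed

lemma remove_add_cycle: "remove_cycle cs \<sigma> = \<tau>"
proof
  fix x
  show "remove_cycle cs \<sigma> x = \<tau> x"
    using permutes_not_in[OF \<tau>, of x] by (auto simp: remove_cycle_def add_cycle_def)
qed

end


text \<open>
  Converse of the extension by a cycle: every permutation arises from its cycle through \<open>a\<close> and its
  restriction to the complement.
\<close>

lemma split_off_cycle:
  assumes L: "finite L" "a \<in> L" and \<sigma>: "\<sigma> permutes L"
  defines "cs \<equiv> support \<sigma> a"
  shows "cs = a # tl cs" "distinct cs" "set (tl cs) \<subseteq> L - {a}"
    "remove_cycle cs \<sigma> permutes L - {a} - set (tl cs)" "add_cycle cs (remove_cycle cs \<sigma>) = \<sigma>"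
proof -
  have p: "permutation \<sigma>" by (rule permutation_onI[OF L(1) \<sigma>])
  then have "least_power \<sigma> a > 0" by (rule least_power_of_permutation(2))
  then show cs: "cs = a # tl cs" by (simp add: cs_def upt_conv_Cons)
  show dist: "distinct cs" unfolding cs_def by (rule cycle_of_permutation[OF p])
  have set_cs: "set cs = orbit \<sigma> a" unfolding cs_def by (rule set_support_eq_orbit[OF p])
  then have sub: "set cs \<subseteq> L" using permutes_orbit_subset[OF \<sigma> L(2)] by simp
  have "a \<notin> set (tl cs)" "set (tl cs) \<subseteq> set cs" using dist cs by (metis distinct.simps(2), metis set_subset_Cons)
  with sub show "set (tl cs) \<subseteq> L - {a}" by blast
  have rest: "L - {a} - set (tl cs) = L - set cs"
  proof -
    have "set cs = insert a (set (tl cs))" using cs by (metis list.simps(15))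
    then show ?thesis by blast
  qed
  have "\<sigma> x \<in> set cs" if "x \<in> set cs" for x
    using that unfolding set_cs by (rule orbit.step)
  then have "\<sigma> ` set cs = set cs"
    using permutes_inj_on[OF \<sigma>] by (intro endo_inj_surj) auto
  then have "bij_betw \<sigma> (set cs) (set cs)"
    using permutes_inj_on[OF \<sigma>] by (simp add: bij_betw_def)
  then have "bij_betw \<sigma> (L - set cs) (L - set cs)"
    using permutes_imp_bij[OF \<sigma>] sub by (intro bij_betw_DiffI)
  moreover have "bij_betw \<sigma> (L - set cs) (L - set cs) \<longleftrightarrow>
      bij_betw (remove_cycle cs \<sigma>) (L - set cs) (L - set cs)"
    by (rule bij_betw_cong) (simp add: remove_cycle_def)
  ultimately show "remove_cycle cs \<sigma> permutes L - {a} - set (tl cs)"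
    unfolding rest using permutes_not_in[OF \<sigma>]
    by (intro bij_imp_permutes) (auto simp: remove_cycle_def)
  show "add_cycle cs (remove_cycle cs \<sigma>) = \<sigma>"
  proof
    fix x
    have "cycle_of_list cs x = \<sigma> x" if "x \<in> set cs"
      using cycle_restrict[OF p, of x a] that by (simp add: cs_def)
    then show "add_cycle cs (remove_cycle cs \<sigma>) x = \<sigma> x"
      by (simp add: add_cycle_def remove_cycle_def)
  qed
qed

lemma sum_cycle_andre_split:
  assumes L: "finite L" "a \<in> L" "\<And>x. x \<in> L \<Longrightarrow> a \<le> x"
  shows "(\<Sum>\<sigma>\<in>cycle_andre_on L. f \<sigma>) = (\<Sum>U\<in>Pow (L - {a}). \<Sum>u\<in>A1.words U.
           \<Sum>\<tau>\<in>cycle_andre_on (L - {a} - U). f (add_cycle (a # u) \<tau>))"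
proof -
  let ?T = "SIGMA U : Pow (L - {a}). A1.words U \<times> cycle_andre_on (L - {a} - U)"
  let ?del = "\<lambda>\<sigma>. let cs = support \<sigma> a in (set (tl cs), tl cs, remove_cycle cs \<sigma>)"
  have fin: "finite (cycle_andre_on M)" if "finite M" for M
    using finite_permutations[OF that] by (rule rev_finite_subset) (auto simp: cycle_andre_on_def)
  have "(\<Sum>\<sigma>\<in>cycle_andre_on L. f \<sigma>) = (\<Sum>(U, u, \<tau>)\<in>?T. f (add_cycle (a # u) \<tau>))"
  proof (rule sum.reindex_bij_witness[where j = ?del and i = "\<lambda>(U, u, \<tau>). add_cycle (a # u) \<tau>"])
    fix \<sigma> assume \<sigma>: "\<sigma> \<in> cycle_andre_on L"
    then have "\<sigma> permutes L" by (simp add: cycle_andre_on_def)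
    define u where "u = tl (support \<sigma> a)"
    define \<tau> where "\<tau> = remove_cycle (support \<sigma> a) \<sigma>"
    note split = split_off_cycle[OF L(1,2) \<open>\<sigma> permutes L\<close>, folded u_def \<tau>_def]
    have \<sigma>_eq: "add_cycle (a # u) \<tau> = \<sigma>" using split(1,5) by metis
    have "distinct u" using split(1,2) by (metis distinct.simps(2))
    have ext: "cycle_extension L a u \<tau>"
      using L split(3,4) \<open>distinct u\<close> by unfold_locales
    note iff = cycle_extension.add_cycle_andre_iff[OF ext, unfolded \<sigma>_eq]
    have del: "?del \<sigma> = (set u, u, \<tau>)" by (simp add: Let_def u_def \<tau>_def)
    show "(\<lambda>(U, u, \<tau>). add_cycle (a # u) \<tau>) (?del \<sigma>) = \<sigma>"
      "(case ?del \<sigma> of (U, u, \<tau>) \<Rightarrow> f (add_cycle (a # u) \<tau>)) = f \<sigma>"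
      unfolding del by (simp_all add: \<sigma>_eq)
    show "?del \<sigma> \<in> ?T"
      unfolding del using iff \<sigma> split(3) \<open>distinct u\<close> by (simp add: A1.words_def permutations_of_set_def)
  next
    fix b assume "b \<in> ?T"
    then obtain U u \<tau> where b: "b = (U, u, \<tau>)" "U \<subseteq> L - {a}" "u \<in> A1.words U"
      "\<tau> \<in> cycle_andre_on (L - {a} - U)" by auto
    then have u: "set u = U" "distinct u" "andre1 u"
      by (auto simp: A1.words_def dest: permutations_of_setD)
    have \<tau>: "\<tau> permutes L - {a} - set u" using b(4) u(1) by (simp add: cycle_andre_on_def)
    have sub: "set u \<subseteq> L - {a}" using b u by simp
    have ext: "cycle_extension L a u \<tau>" using L sub u(2) \<tau> by unfold_locales
    show "(\<lambda>(U, u, \<tau>). add_cycle (a # u) \<tau>) b \<in> cycle_andre_on L"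
      using cycle_extension.add_cycle_andre_iff[OF ext] u b by simp
    show "?del ((\<lambda>(U, u, \<tau>). add_cycle (a # u) \<tau>) b) = b"
      unfolding b(1) split_conv cycle_extension.support_add_cycle[OF ext] Let_def cycle_extension.remove_add_cycle[OF ext]
      by (simp add: u)
  qed
  also have "\<dots> = (\<Sum>U\<in>Pow (L - {a}). \<Sum>(u, \<tau>)\<in>A1.words U \<times> cycle_andre_on (L - {a} - U).
       f (add_cycle (a # u) \<tau>))"
    using L(1) fin by (subst sum.Sigma) (auto simp: split_def finite_subset A1.words_def)
  also have "\<dots> = (\<Sum>U\<in>Pow (L - {a}). \<Sum>u\<in>A1.words U.
           \<Sum>\<tau>\<in>cycle_andre_on (L - {a} - U). f (add_cycle (a # u) \<tau>))"
    by (simp only: sum.cartesian_product)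
  finally show ?thesis .
qed

text \<open>
  A cycle \<open>(a, u)\<close> with nonempty \<open>u\<close> has \<open>des u + 1\<close> drops, and \<open>2 des u < length u\<close>; fixed points have
  none.
\<close>

lemma drops_bound:
  assumes "finite L" "\<sigma> \<in> cycle_andre_on L"
  shows "2 * drops_on L \<sigma> \<le> card L"
  using assms
proof (induction arbitrary: \<sigma> rule: finite_psubset_induct)
  case (psubset L)
  show ?case
  proof (cases "L = {}")
    case False
    define a where "a = Min L"
    have L: "finite L" "a \<in> L" "\<And>x. x \<in> L \<Longrightarrow> a \<le> x" using psubset.hyps False by (auto simp: a_def)
    have \<sigma>: "\<sigma> permutes L" using psubset.prems by (simp add: cycle_andre_on_def)
    define u where "u = tl (support \<sigma> a)"
    define \<tau> where "\<tau> = remove_cycle (support \<sigma> a) \<sigma>"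
    note split = split_off_cycle[OF L(1,2) \<sigma>, folded u_def \<tau>_def]
    have \<sigma>_eq: "add_cycle (a # u) \<tau> = \<sigma>" using split(1,5) by metis
    have "distinct u" using split(1,2) by (metis distinct.simps(2))
    have ext: "cycle_extension L a u \<tau>"
      using L split(3,4) \<open>distinct u\<close> by unfold_locales
    have "andre1 u" "\<tau> \<in> cycle_andre_on (L - {a} - set u)"
      using cycle_extension.add_cycle_andre_iff[OF ext] psubset.prems by (simp_all add: \<sigma>_eq)
    moreover have "L - {a} - set u \<subset> L" using L(2) by blast
    ultimately have "2 * drops_on (L - {a} - set u) \<tau> \<le> card (L - {a} - set u)"
      using psubset.IH by blast
    moreover have "card L = card (L - {a} - set u) + 1 + length u"
    proof -
      have "card (L - {a} - set u) = card (L - {a}) - length u"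
        using split(3) by (subst card_Diff_subset) (simp_all add: distinct_card[OF \<open>distinct u\<close>])
      moreover have "length u \<le> card (L - {a})"
        using card_mono[OF _ split(3)] L(1) by (simp add: distinct_card[OF \<open>distinct u\<close>])
      moreover have "card L = card (L - {a}) + 1" using L(1,2) by (simp add: card_Suc_Diff1 del: card_Diff_insert)
      ultimately show ?thesis by linarith
    qed
    moreover have "drops_on L \<sigma> = drops_on (L - {a} - set u) \<tau> + (if u = [] then 0 else des u + 1)"
      using cycle_extension.drops_add_cycle[OF ext] by (simp add: \<sigma>_eq)
    moreover have "u = [] \<or> 2 * des u < length u" using A1.des_bound[OF \<open>andre1 u\<close>] by blast
    ultimately show ?thesis by (auto split: if_splits)
  qed (simp add: drops_on_def)
qed

definition cycle_weight :: "'a::comm_semiring_1 \<Rightarrow> 'a \<Rightarrow> 'a \<Rightarrow> 'a \<Rightarrow> nat set \<Rightarrow> (nat \<Rightarrow> nat) \<Rightarrow> 'a" where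
  "cycle_weight p s t a L \<sigma> =
     p ^ drops_on L \<sigma> * s ^ (card L - 2 * drops_on L \<sigma>) * (t ^ fixpts_on L \<sigma> * a ^ cyc_on L \<sigma>)"

definition cycle_sum :: "'a::comm_semiring_1 \<Rightarrow> 'a \<Rightarrow> 'a \<Rightarrow> 'a \<Rightarrow> nat set \<Rightarrow> 'a" where
  "cycle_sum p s t a L = (\<Sum>\<sigma>\<in>cycle_andre_on L. cycle_weight p s t a L \<sigma>)"

lemma cycle_weight_add_cycle:
  assumes L: "finite L" "b \<in> L" "\<And>x. x \<in> L \<Longrightarrow> b \<le> x"
    and u: "set u \<subseteq> L - {b}" "distinct u" "andre1 u"
    and \<tau>: "\<tau> \<in> cycle_andre_on (L - {b} - set u)"
  shows "cycle_weight p s t a L (add_cycle (b # u) \<tau>) =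
    a * (if u = [] then t * s else p * andre_weight p s 1 1 u) * cycle_weight p s t a (L - {b} - set u) \<tau>"
proof -
  let ?L' = "L - {b} - set u"
  have perm: "\<tau> permutes ?L'" using \<tau> by (simp add: cycle_andre_on_def)
  have ext: "cycle_extension L b u \<tau>" using L u(1,2) perm by unfold_locales
  note stats = cycle_extension.drops_add_cycle[OF ext] cycle_extension.fixpts_add_cycle[OF ext] cycle_extension.cyc_add_cycle[OF ext]
  have bound: "2 * drops_on ?L' \<tau> \<le> card ?L'" using drops_bound[OF _ \<tau>] L(1) by simp
  have card: "card L = card ?L' + 1 + length u"
  proof -
    have "card ?L' = card (L - {b}) - length u"
      using u by (subst card_Diff_subset) (simp_all add: distinct_card)
    moreover have "length u \<le> card (L - {b})"
      using card_mono[OF _ u(1)] L(1) by (simp add: distinct_card[OF u(2)])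
    moreover have "card L = card (L - {b}) + 1" using L(1,2) by (simp add: card_Suc_Diff1 del: card_Diff_insert)
    ultimately show ?thesis by linarith
  qed
  show ?thesis
  proof (cases "u = []")
    case True
    then have "card L - 2 * drops_on ?L' \<tau> = Suc (card ?L' - 2 * drops_on ?L' \<tau>)"
      using bound card by simp
    then show ?thesis using stats True unfolding cycle_weight_def by (simp add: mult_ac)
  next
    case False
    then have "2 * des u < length u" using A1.des_bound u by blast
    then obtain j where "length u = Suc (2 * des u + j)" using less_iff_Suc_add by blast
    moreover obtain k where "card ?L' = 2 * drops_on ?L' \<tau> + k" using bound le_Suc_ex by blast
    ultimately have "card L - 2 * (drops_on ?L' \<tau> + (des u + 1)) =
        (length u - 1 - 2 * des u) + (card ?L' - 2 * drops_on ?L' \<tau>)"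
      unfolding card by simp
    then show ?thesis using stats False unfolding cycle_weight_def andre_weight_def
      by (simp add: power_add mult_ac del: mult_Suc_right add_mult_distrib2)
  qed
qed

lemma cycle_sum_removal:
  fixes p s t a :: "'a::comm_semiring_1"
  assumes L: "finite L" "0 < card L"
  shows "removal_step p s t a 0 (A1.wsum p s 1 1) (cycle_sum p s t a) L"
proof -
  define b where "b = Min L"
  have "L \<noteq> {}" using L by auto
  then have b: "b \<in> L" "\<And>x. x \<in> L \<Longrightarrow> b \<le> x" using L(1) by (auto simp: b_def)
  let ?g = "\<lambda>u. if u = [] then t * s else p * andre_weight p s 1 1 u"
  have "cycle_sum p s t a L = (\<Sum>U\<in>Pow (L - {b}). \<Sum>u\<in>A1.words U.
      \<Sum>\<tau>\<in>cycle_andre_on (L - {b} - U). cycle_weight p s t a L (add_cycle (b # u) \<tau>))"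
    unfolding cycle_sum_def by (rule sum_cycle_andre_split[OF L(1) b])
  also have "\<dots> = (\<Sum>U\<in>Pow (L - {b}). \<Sum>u\<in>A1.words U.
      \<Sum>\<tau>\<in>cycle_andre_on (L - {b} - U). a * ?g u * cycle_weight p s t a (L - {b} - U) \<tau>)"
  proof (intro sum.cong refl)
    fix U u \<tau> assume *: "U \<in> Pow (L - {b})" "u \<in> A1.words U" "\<tau> \<in> cycle_andre_on (L - {b} - U)"
    then have "set u = U" "distinct u" "andre1 u"
      by (auto simp: A1.words_def dest: permutations_of_setD)
    then show "cycle_weight p s t a L (add_cycle (b # u) \<tau>) = a * ?g u * cycle_weight p s t a (L - {b} - U) \<tau>"
      using cycle_weight_add_cycle[OF L(1) b, of u \<tau> p s t a] * by simp
  qed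
  also have "\<dots> = (\<Sum>U\<in>Pow (L - {b}). (\<Sum>u\<in>A1.words U. a * ?g u) * cycle_sum p s t a (L - {b} - U))"
    by (simp add: sum_product cycle_sum_def)
  also have "\<dots> = a * (t * s) * cycle_sum p s t a (L - {b}) +
      (\<Sum>U\<in>Pow (L - {b}) - {{}}. (\<Sum>u\<in>A1.words U. a * ?g u) * cycle_sum p s t a (L - {b} - U))"
    using L(1) by (subst sum.remove[of _ "{}"]) (auto simp: A1.words_def A1.A_Nil Collect_conv_if)
  also have "(\<Sum>U\<in>Pow (L - {b}) - {{}}. (\<Sum>u\<in>A1.words U. a * ?g u) * cycle_sum p s t a (L - {b} - U)) =
      (\<Sum>U\<in>Pow (L - {b}) - {{}}. a * (p * (A1.wsum p s 1 1 U * cycle_sum p s t a (L - {b} - U))))"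
  proof (intro sum.cong refl)
    fix U assume "U \<in> Pow (L - {b}) - {{}}"
    then have "(\<Sum>u\<in>A1.words U. a * ?g u) = (\<Sum>u\<in>A1.words U. a * p * andre_weight p s 1 1 u)"
      by (intro sum.cong) (auto simp: A1.words_def permutations_of_set_def mult_ac)
    then show "(\<Sum>u\<in>A1.words U. a * ?g u) * cycle_sum p s t a (L - {b} - U) =
        a * (p * (A1.wsum p s 1 1 U * cycle_sum p s t a (L - {b} - U)))"
      by (simp add: A1.wsum_def sum_distrib_left[symmetric] mult_ac)
  qed
  finally have "cycle_sum p s t a L = a * (t * s * cycle_sum p s t a (L - {b}) +
      p * (\<Sum>U\<in>Pow (L - {b}) - {{}}. A1.wsum p s 1 1 U * cycle_sum p s t a (L - {b} - U)))"
    by (simp add: sum_distrib_left distrib_left mult_ac)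
  moreover have "card L = Suc (card (L - {b}) + 0)" using b L by simp
  ultimately show ?thesis using b(1) unfolding removal_step_def by blast
qed

lemma cycle_sum_empty: "cycle_sum p s t a {} = 1"
proof -
  have "cycle_andre_on {} = {id}" by (auto simp: cycle_andre_on_def)
  then show ?thesis
    by (simp add: cycle_sum_def cycle_weight_def drops_on_def fixpts_on_def cyc_on_def)
qed

lemma cycle_sum_eq_path_sum:
  assumes "finite L" "0 \<notin> L"
  shows "cycle_sum p s t a L = path_sum p s t a (card L)"
proof -
  have "cycle_sum p s t a L = path_sum p s t a (card L - 0)"
  proof (rule path_sum_unique)
    fix U :: "nat set" assume "finite U" "0 \<notin> U" "U \<noteq> {}"
    then show "A1.wsum p s 1 1 U = path_sum p s 1 1 (card U - 1)"
      by (rule A1.wsum_eq_path_sum)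
  next
    fix L :: "nat set" assume "finite L" "0 \<notin> L" "0 < card L"
    then show "removal_step p s t a 0 (A1.wsum p s 1 1) (cycle_sum p s t a) L"
      by (intro cycle_sum_removal)
  qed (use assms in \<open>auto simp: cycle_sum_empty\<close>)
  then show ?thesis by simp
qed

section \<open>Gamma-coefficients\<close>

lemma const_xy_mult: "const_xy (a * b) = const_xy a * const_xy b"
  and const_xy_1: "const_xy 1 = 1"
  and const_xy_0: "const_xy 0 = 0"
  and const_xy_add: "const_xy (a + b) = const_xy a + const_xy b"
  and const_xy_diff: "const_xy (a - b) = const_xy a - const_xy b"
  by (simp_all add: const_xy_def one_pCons)

lemma const_xy_power: "const_xy (a ^ k) = const_xy a ^ k"
  by (induction k) (simp_all add: const_xy_mult const_xy_1)

lemma const_xy_sum: "const_xy (\<Sum>i\<in>I. f i) = (\<Sum>i\<in>I. const_xy (f i))"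
  by (induction I rule: infinite_finite_induct) (simp_all add: const_xy_add const_xy_0)

lemma const_xy_2: "const_xy 2 = 2"
  using const_xy_add[of 1 1] by (simp add: const_xy_1)

text \<open>
  The polynomials \<open>(x y)\<^sup>j (x + y)\<^sup>n\<^sup>-\<^sup>2\<^sup>j\<close> have distinct orders of vanishing at \<open>x = 0\<close>. Once the
  coefficients before \<open>j\<close> are known to vanish, \<open>x\<^sup>j\<close> can be divided out, and putting \<open>x = 0\<close> isolates
  the coefficient with index \<open>j\<close>.
\<close>

lemma gamma_expansion_zero:
  assumes "(\<Sum>j\<le>n div 2. const_xy (g j) * (var_x * var_y) ^ j * (var_x + var_y) ^ (n - 2 * j)) = 0"
  shows "j \<le> n div 2 \<Longrightarrow> g j = 0"
proof (induction j rule: less_induct)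
  case (less j)
  let ?q = "\<lambda>i. const_xy (g i) * var_x ^ (i - j) * var_y ^ i * (var_x + var_y) ^ (n - 2 * i)"
  have "(\<Sum>i\<le>n div 2. const_xy (g i) * (var_x * var_y) ^ i * (var_x + var_y) ^ (n - 2 * i)) =
        (\<Sum>i\<in>{j..n div 2}. const_xy (g i) * (var_x * var_y) ^ i * (var_x + var_y) ^ (n - 2 * i))"
    using less by (intro sum.mono_neutral_right) (auto simp: const_xy_0)
  also have "\<dots> = (\<Sum>i\<in>{j..n div 2}. var_x ^ j * ?q i)"
  proof (intro sum.cong refl)
    fix i assume "i \<in> {j..n div 2}"
    then have "var_x ^ i = var_x ^ j * var_x ^ (i - j)" by (simp flip: power_add)
    then show "const_xy (g i) * (var_x * var_y) ^ i * (var_x + var_y) ^ (n - 2 * i) = var_x ^ j * ?q i"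
      by (simp add: power_mult_distrib mult_ac)
  qed
  also have "\<dots> = var_x ^ j * (\<Sum>i\<in>{j..n div 2}. ?q i)" by (simp add: sum_distrib_left)
  finally have "var_x ^ j * (\<Sum>i\<in>{j..n div 2}. ?q i) = 0" using assms by simp
  moreover have "var_x ^ j \<noteq> 0" by (simp add: var_x_def)
  ultimately have "(\<Sum>i\<in>{j..n div 2}. ?q i) = 0" by (simp only: mult_eq_0_iff simp_thms)
  then have "0 = poly (\<Sum>i\<in>{j..n div 2}. ?q i) 0" by simp
  also have "\<dots> = (\<Sum>i\<in>{j..n div 2}. if i = j then poly (?q j) 0 else 0)"
    unfolding poly_sum by (intro sum.cong refl) (auto simp: var_x_def)
  also have "\<dots> = poly (?q j) 0" using less.prems by simp
  also have "\<dots> = [:g j:] * [:0, 1:] ^ j * [:0, 1:] ^ (n - 2 * j)"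
    by (simp add: const_xy_def var_x_def var_y_def)
  finally show "g j = 0" by simp
qed

lemma gamma_coeff_eq:
  assumes "A_poly n = (\<Sum>j\<le>n div 2. const_xy (g j) * (var_x * var_y) ^ j * (var_x + var_y) ^ (n - 2 * j))"
    and "\<And>j. j > n div 2 \<Longrightarrow> g j = 0"
  shows "gamma_coeff n = g"
  unfolding gamma_coeff_def
proof (rule the_equality)
  fix h
  assume h: "(\<forall>j > n div 2. h j = 0) \<and> A_poly n =
    (\<Sum>j\<le>n div 2. const_xy (h j) * (var_x * var_y) ^ j * (var_x + var_y) ^ (n - 2 * j))"
  have "h j - g j = 0" if "j \<le> n div 2" for j
    by (rule gamma_expansion_zero[OF _ that])
       (use h assms(1) in \<open>simp add: const_xy_diff left_diff_distrib sum_subtractf\<close>)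
  then show "h = g" using h assms(2) by (metis eq_iff_diff_eq_0 ext not_le_imp_less)
qed (use assms in auto)

lemma smult_inverse_power_2: "smult [:1 / 2 ^ j:] (2 ^ j * c) = (c :: rat poly poly)"
proof -
  have "smult [:1 / 2 ^ j:] (2 ^ j :: rat poly poly) = 1"
  proof (induction j)
    case (Suc j)
    have "smult [:1 / 2 ^ Suc j:] (2 ^ Suc j :: rat poly poly)
        = smult [:1 / 2:] 2 * smult [:1 / 2 ^ j:] (2 ^ j)"
      by (simp add: mult_ac)
    also have "smult [:1 / 2:] (2 :: rat poly poly) = 1"
      by (simp add: numeral_poly one_pCons)
    finally show ?case using Suc by simp
  qed (simp add: one_pCons)
  then show ?thesis by (metis mult_1 mult_smult_left)
qed

text \<open>
  Grouping a sum with \<open>p = 2xy\<close> and \<open>s = x + y\<close> by the exponent of \<open>p\<close> gives a gamma-expansion, whose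
  coefficients are the partial sums multiplied by \<open>2\<^sup>j\<close>.
\<close>

lemma d_coeff_eq:
  assumes S: "finite S" "\<And>s. s \<in> S \<Longrightarrow> 2 * f s \<le> n" and j: "j \<le> n div 2"
    and A: "A_poly n = (\<Sum>s\<in>S. (2 * (var_x * var_y)) ^ f s * (var_x + var_y) ^ (n - 2 * f s) * const_xy (wt s))"
  shows "d_coeff n j = (\<Sum>s\<in>{s \<in> S. f s = j}. wt s)"
proof -
  define c where "c j = (\<Sum>s\<in>{s \<in> S. f s = j}. wt s)" for j
  have "gamma_coeff n = (\<lambda>j. 2 ^ j * c j)"
  proof (rule gamma_coeff_eq)
    have "A_poly n = (\<Sum>j\<le>n div 2. \<Sum>s\<in>{s \<in> S. f s = j}.
        (2 * (var_x * var_y)) ^ f s * (var_x + var_y) ^ (n - 2 * f s) * const_xy (wt s))"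
      unfolding A using S by (intro sum.group[symmetric]) (auto, fastforce)
    also have "\<dots> = (\<Sum>j\<le>n div 2. const_xy (2 ^ j * c j) * (var_x * var_y) ^ j * (var_x + var_y) ^ (n - 2 * j))"
      by (intro sum.cong refl) (simp add: c_def const_xy_mult const_xy_power const_xy_2 const_xy_sum
          sum_distrib_left sum_distrib_right power_mult_distrib mult_ac)
    finally show "A_poly n = (\<Sum>j\<le>n div 2.
        const_xy (2 ^ j * c j) * (var_x * var_y) ^ j * (var_x + var_y) ^ (n - 2 * j))" .
    fix j assume "j > n div 2"
    then have "{s \<in> S. f s = j} = {}" using S(2) by fastforce
    then show "2 ^ j * c j = 0" by (simp only: c_def sum.empty mult_zero_right)
  qed
  then show ?thesis by (simp add: d_coeff_def smult_inverse_power_2 c_def)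
qed

theorem theorem2p9:
  fixes n j :: nat
  assumes "j \<le> n div 2"
  shows "d_coeff n j =
           (\<Sum>\<sigma> \<in> {\<sigma> \<in> CA n. drops n \<sigma> = j}. var_t ^ fixpts n \<sigma> * var_\<alpha> ^ cyc n \<sigma>)
       \<and> d_coeff n j =
           (\<Sum>w \<in> {w \<in> Andre1 (n + 1). des w = j}. var_t ^ rminda w * var_\<alpha> ^ (rmin w - 1))
       \<and> d_coeff n j =
           (\<Sum>w \<in> {w \<in> Andre2 (n + 1). des w = j}. var_t ^ rminda w * var_\<alpha> ^ (rmin w - 1))"
proof -
  let ?p = "2 * (var_x * var_y)" and ?s = "var_x + var_y"
  let ?t = "const_xy var_t" and ?a = "const_xy var_\<alpha>"
  have "A_poly n = max_sum var_x var_y ?t ?a {1..n + 1}"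
    by (simp add: A_poly_def max_sum_def max_weight_def const_xy_mult const_xy_power)
  then have A: "A_poly n = path_sum ?p ?s ?t ?a n"
    by (simp add: max_sum_eq_path_sum)
  have CA: "CA n = cycle_andre_on {1..n}" by (simp add: CA_def cycle_andre_on_def)
  have 1: "d_coeff n j = (\<Sum>\<sigma>\<in>{\<sigma> \<in> CA n. drops n \<sigma> = j}. var_t ^ fixpts n \<sigma> * var_\<alpha> ^ cyc n \<sigma>)"
  proof (rule d_coeff_eq[OF _ _ assms])
    show "finite (CA n)"
      using finite_permutations[of "{1..n}"] by (rule rev_finite_subset) (auto simp: CA_def)
    show "2 * drops n \<sigma> \<le> n" if "\<sigma> \<in> CA n" for \<sigma>
      using drops_bound[of "{1..n}" \<sigma>] that by (simp add: CA drops_def drops_on_def)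
    have "A_poly n = cycle_sum ?p ?s ?t ?a {1..n}" by (simp add: A cycle_sum_eq_path_sum)
    then show "A_poly n = (\<Sum>\<sigma>\<in>CA n. ?p ^ drops n \<sigma> * ?s ^ (n - 2 * drops n \<sigma>) *
        const_xy (var_t ^ fixpts n \<sigma> * var_\<alpha> ^ cyc n \<sigma>))"
      by (simp add: cycle_sum_def cycle_weight_def CA drops_def drops_on_def fixpts_def fixpts_on_def
          cyc_def cyc_on_def const_xy_mult const_xy_power)
  qed
  have 2: "d_coeff n j = (\<Sum>w\<in>{w \<in> Andre1 (n + 1). des w = j}. var_t ^ rminda w * var_\<alpha> ^ (rmin w - 1))"
  proof (rule d_coeff_eq[OF _ _ assms])
    have words: "Andre1 (n + 1) = A1.words {1..n + 1}" by (simp add: Andre1_def A1.words_def)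
    have len: "length w = n + 1" if "w \<in> Andre1 (n + 1)" for w
      using that length_finite_permutations_of_set by (fastforce simp: Andre1_def)
    show "finite (Andre1 (n + 1))" by (simp only: words A1.finite_words finite_atLeastAtMost)
    show "2 * des w \<le> n" if "w \<in> Andre1 (n + 1)" for w
      using A1.des_bound[of w] len[OF that] that by (force simp: Andre1_def)
    have "A_poly n = A1.wsum ?p ?s ?t ?a {1..n + 1}" by (simp add: A A1.wsum_eq_path_sum)
    then show "A_poly n = (\<Sum>w\<in>Andre1 (n + 1). ?p ^ des w * ?s ^ (n - 2 * des w) *
        const_xy (var_t ^ rminda w * var_\<alpha> ^ (rmin w - 1)))"
      unfolding A1.wsum_def words[symmetric]
      by (simp add: andre_weight_def len const_xy_mult const_xy_power)
  qed
  have 3: "d_coeff n j = (\<Sum>w\<in>{w \<in> Andre2 (n + 1). des w = j}. var_t ^ rminda w * var_\<alpha> ^ (rmin w - 1))"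
  proof (rule d_coeff_eq[OF _ _ assms])
    have words: "Andre2 (n + 1) = A2.words {1..n + 1}" by (simp add: Andre2_def A2.words_def)
    have len: "length w = n + 1" if "w \<in> Andre2 (n + 1)" for w
      using that length_finite_permutations_of_set by (fastforce simp: Andre2_def)
    show "finite (Andre2 (n + 1))" by (simp only: words A2.finite_words finite_atLeastAtMost)
    show "2 * des w \<le> n" if "w \<in> Andre2 (n + 1)" for w
      using A2.des_bound[of w] len[OF that] that by (force simp: Andre2_def)
    have "A_poly n = A2.wsum ?p ?s ?t ?a {1..n + 1}" by (simp add: A A2.wsum_eq_path_sum)
    then show "A_poly n = (\<Sum>w\<in>Andre2 (n + 1). ?p ^ des w * ?s ^ (n - 2 * des w) *
        const_xy (var_t ^ rminda w * var_\<alpha> ^ (rmin w - 1)))"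
      unfolding A2.wsum_def words[symmetric]
      by (simp add: andre_weight_def len const_xy_mult const_xy_power)
  qed
  from 1 2 3 show ?thesis by blast
qed

end
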